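(* Let $\kappa$ be a regular uncountable cardinal, $\Gamma_0$ a nonempty chain, $(\Gamma_\kappa,\iota_\kappa)$ the $\kappa$-th iterated lexicographic power of $\Gamma_0$ (with chains $\Gamma_\mu$, $\mu\le\kappa$), $G_\kappa=(\mathbb{R}^{\Gamma_\kappa})_\kappa$ and $K=\mathbb{R}((G_\kappa))_\kappa$. Let $\sigma$ be an automorphism of $\Gamma_\kappa$ such that $\sigma|_{\Gamma_\mu}$ is an automorphism of $\Gamma_\mu$ for all $\mu<\kappa$ and $\sigma(\gamma)>\gamma$ for all $\gamma\in\Gamma_0$; put $l:=\iota_\kappa\circ\sigma$ and $\sigma_0:=\sigma|_{\Gamma_0}$. Let $\log$ be the logarithm on $K^{>0}$ defined, for $a=t^gr(1+\varepsilon)$ with $g=\sum_{\gamma\in\Gamma_\kappa}g_\gamma1_\gamma\in G_\kappa$, $r\in\mathbb{R}^{>0}$, $\varepsilon$ infinitesimal, by $\log(a)=\sum_{\gamma\in\Gamma_\kappa}-g_\gamma t^{l(\gamma)}+\log r+\sum_{i=1}^\infty(-1)^{i-1}\varepsilon^i/i$. Then the logarithmic rank of $(K^{>0},\log)$ is equal to the rank of $(\Gamma_0,\sigma_0)$.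
   Context: For a chain $\Delta$, $(\mathbb{R}^\Delta)_\kappa$ is the set of maps $g:\Delta\to\mathbb{R}$ with well-ordered support of cardinality $<\kappa$, pointwise addition and lexicographic order ($g>0$ iff $g(\min\mathrm{support}\,g)>0$); $1_\delta$ is the characteristic function of $\{\delta\}$; for $\Delta\subseteq\Delta'$, $(\mathbb{R}^\Delta)_\kappa$ is viewed inside $(\mathbb{R}^{\Delta'})_\kappa$ by extension by $0$. $\mathbb{R}((G))_\kappa$ is the ordered field of formal series $\sum_{g\in G}s_gt^g$ with real coefficients and well-ordered support of cardinality $<\kappa$, with valuation $v(s)=\min\mathrm{support}(s)$ and valuation ring $R_v=\{x:v(x)\ge0\}\cup\{0\}$; $\varepsilon$ infinitesimal means $\varepsilon=0$ or $v(\varepsilon)>0$; $\log r$ is the natural logarithm of a positive real. The $\kappa$-th iterated lexicographic power: by recursion on $\mu\le\kappa$ one defines chains $\Gamma_\mu$, $G_\mu:=(\mathbb{R}^{\Gamma_\mu})_\kappa$ and order embeddings $\iota_\mu:\Gamma_\mu\to G_\mu^{<0}$: $\iota_0(\gamma)=-1_\gamma$; $\Gamma_{\alpha+1}$ is the disjoint union $\Gamma_\alpha\sqcup(G_\alpha^{<0}\setminus\iota_\alpha(\Gamma_\alpha))$ ordered by comparing elements of $\Gamma_\alpha$ in $\Gamma_\alpha$, elements of $G_\alpha^{<0}$ in $G_\alpha$, and for $\gamma_1\in\Gamma_\alpha$, $\gamma_2$ new, $\gamma_1<\gamma_2$ iff $\iota_\alpha(\gamma_1)<\gamma_2$ in $G_\alpha$;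 $\iota_{\alpha+1}$ is $\iota_\alpha$ on $\Gamma_\alpha$ and the identity on the new part; at limits take unions. $\Gamma_\kappa=\bigcup_{\alpha<\kappa}\Gamma_\alpha$, $\iota_\kappa=\bigcup_\alpha\iota_\alpha$; $\iota_\kappa$ is an order isomorphism of $\Gamma_\kappa$ onto $G_\kappa^{<0}$. Rank: for a chain $\Gamma$ and an automorphism $\tau$ with $\tau(\gamma)>\gamma$ for all $\gamma$, let $\gamma\sim_\tau\gamma'$ iff there is $n\in\mathbb{N}$ with $\tau^n(\gamma)\ge\gamma'$ and $\tau^n(\gamma')\ge\gamma$; the classes are convex, so $\Gamma/{\sim_\tau}$ is a chain, and its order type is the rank of $(\Gamma,\tau)$. Logarithmic rank: on $K^{>0}\setminus R_v$ let $a\sim_{\log}a'$ iff there is $n\in\mathbb{N}$ with $\log_n(a)\le a'$ and $\log_n(a')\le a$, where $\log_n$ is the $n$-th iterate of $\log$; the classes are convex, and the order type of the chain of classes is the logarithmic rank of $(K^{>0},\log)$. "Equal" means equal order types.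
   Formalization: The chain of log-classes carries the reverse of the order induced by K (larger series first, as for valuations); with the induced order the claim fails, e.g. for Γ₀=ℕ×ℤ lexicographic and σ₀ the shift on ℤ, where the rank is ω but the induced order type is ω*. *)

theory Defs
  imports Complex_Main "HOL-Library.Function_Algebras" "HOL-Library.Indicator_Function"
begin

unbundle cardinal_syntax

text \<open>
  A chain is a reflexive linear order \<open>\<Delta>\<close> given as a relation, with carrier \<^term>\<open>Field \<Delta>\<close>.
  Maps on a chain are total functions that vanish off the carrier, so that the inclusion of
  \<open>(\<real>\<^sup>\<Delta>)\<^sub>\<kappa>\<close> into \<open>(\<real>\<^sup>\<Delta>\<^sup>')\<^sub>\<kappa>\<close> by extension by zero is the identity.
  Sums, differences and \<open>0\<close> of functions are pointwise; \<^term>\<open>indicator {\<delta>}\<close> is \<open>1\<^sub>\<delta>\<close>.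
\<close>

section \<open>The Hahn groups \<open>(\<real>\<^sup>\<Delta>)\<^sub>\<kappa>\<close>\<close>

definition supp :: "('a \<Rightarrow> real) \<Rightarrow> 'a set"
  where "supp g = {x. g x \<noteq> 0}"

definition min_supp :: "'a rel \<Rightarrow> ('a \<Rightarrow> real) \<Rightarrow> 'a"
  where "min_supp \<Delta> g = (THE m. m \<in> supp g \<and> (\<forall>x\<in>supp g. (m, x) \<in> \<Delta>))"

definition hahn :: "'k rel \<Rightarrow> 'a rel \<Rightarrow> ('a \<Rightarrow> real) set"
  where "hahn \<kappa> \<Delta> =
    {g. supp g \<subseteq> Field \<Delta> \<and> well_order_on (supp g) (Restr \<Delta> (supp g)) \<and> |supp g| <o \<kappa>}"

definition lex_pos :: "'a rel \<Rightarrow> ('a \<Rightarrow> real) \<Rightarrow> bool"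
  where "lex_pos \<Delta> g \<longleftrightarrow> g \<noteq> 0 \<and> g (min_supp \<Delta> g) > 0"

definition hahn_order :: "'k rel \<Rightarrow> 'a rel \<Rightarrow> ('a \<Rightarrow> real) rel"
  where "hahn_order \<kappa> \<Delta> =
    {(g, h). g \<in> hahn \<kappa> \<Delta> \<and> h \<in> hahn \<kappa> \<Delta> \<and> (g = h \<or> lex_pos \<Delta> (h - g))}"

definition hahn_neg :: "'k rel \<Rightarrow> 'a rel \<Rightarrow> ('a \<Rightarrow> real) set"
  where "hahn_neg \<kappa> \<Delta> = {g. (g, 0) \<in> hahn_order \<kappa> \<Delta> \<and> g \<noteq> 0}"


section \<open>Iterated lexicographic powers\<close>

text \<open>
  All chains \<open>\<Gamma>\<^sub>\<mu>\<close> are realised inside one type. \<open>Base \<gamma>\<close> is the copy of \<open>\<gamma> \<in> \<Gamma>\<^sub>0\<close>. A nonzero function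
  \<open>g\<close> with support of size at most \<^typ>\<open>'k\<close> is represented by \<^term>\<open>New s\<close>, where \<open>s\<close> is a chosen
  enumeration of the graph of \<open>g\<close> over its support; \<open>new_point\<close> is injective on such functions.
\<close>

datatype ('a, 'k) point = Base 'a | New "'k \<Rightarrow> ('a, 'k) point \<times> real"

definition supp_graph :: "('a \<Rightarrow> real) \<Rightarrow> ('a \<times> real) set"
  where "supp_graph g = {(x, g x) | x. g x \<noteq> 0}"

definition new_point :: "(('a, 'k) point \<Rightarrow> real) \<Rightarrow> ('a, 'k) point"
  where "new_point g = New (SOME s. range s = supp_graph g)"

text \<open>
  Every \<open>\<iota>\<^sub>\<mu>\<close> is \<open>\<gamma> \<mapsto> -1\<^sub>\<gamma>\<close> on \<open>\<Gamma>\<^sub>0\<close> and the identity on each part added later, hence all of them are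
  restrictions of one map, which reads off the represented function (see \<open>iota_new_point\<close> below).
\<close>

fun iota :: "('a, 'k) point \<Rightarrow> ('a, 'k) point \<Rightarrow> real"
  where
    "iota (Base a) = - indicator {Base a}"
  | "iota (New s) = (THE g. supp_graph g = range s)"

definition base_chain :: "'a rel \<Rightarrow> ('a, 'k) point rel"
  where "base_chain \<Gamma>\<^sub>0 = dir_image \<Gamma>\<^sub>0 Base"

definition new_points :: "'k rel \<Rightarrow> ('a, 'k) point rel \<Rightarrow> ('a, 'k) point set"
  where "new_points \<kappa> \<Gamma> = new_point ` (hahn_neg \<kappa> \<Gamma> - iota ` Field \<Gamma>)"

text \<open>
  Two points of which at least one is new are compared through their images in \<open>(\<real>\<^sup>\<Gamma>)\<^sub>\<kappa>\<close>. For an old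
  and a new point these images differ, so \<open>\<le>\<close> between them amounts to \<open><\<close>.
\<close>

definition power_step :: "'k rel \<Rightarrow> ('a, 'k) point rel \<Rightarrow> ('a, 'k) point rel"
  where "power_step \<kappa> \<Gamma> = \<Gamma> \<union>
    {(x, y). x \<in> Field \<Gamma> \<union> new_points \<kappa> \<Gamma> \<and> y \<in> Field \<Gamma> \<union> new_points \<kappa> \<Gamma> \<and>
             (x \<in> new_points \<kappa> \<Gamma> \<or> y \<in> new_points \<kappa> \<Gamma>) \<and>
             (iota x, iota y) \<in> hahn_order \<kappa> \<Gamma>}"

definition is_pred :: "'k rel \<Rightarrow> 'k \<Rightarrow> 'k \<Rightarrow> bool"
  where "is_pred \<kappa> j i \<longleftrightarrow> j \<in> underS \<kappa> i \<and> underS \<kappa> i \<subseteq> under \<kappa> j"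

text \<open>The ordinals \<open>\<mu> < \<kappa>\<close> are the elements of the field of the cardinal order \<open>\<kappa>\<close>.\<close>

definition power_stage :: "'k rel \<Rightarrow> 'a rel \<Rightarrow> 'k \<Rightarrow> ('a, 'k) point rel"
  where "power_stage \<kappa> \<Gamma>\<^sub>0 = wo_rel.worec \<kappa> (\<lambda>\<Gamma> \<mu>.
    if underS \<kappa> \<mu> = {} then base_chain \<Gamma>\<^sub>0
    else if \<exists>\<alpha>. is_pred \<kappa> \<alpha> \<mu> then power_step \<kappa> (\<Gamma> (THE \<alpha>. is_pred \<kappa> \<alpha> \<mu>))
    else (\<Union>\<alpha>\<in>underS \<kappa> \<mu>. \<Gamma> \<alpha>))"

definition power_chain :: "'k rel \<Rightarrow> 'a rel \<Rightarrow> ('a, 'k) point rel"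
  where "power_chain \<kappa> \<Gamma>\<^sub>0 = (\<Union>\<mu>\<in>Field \<kappa>. power_stage \<kappa> \<Gamma>\<^sub>0 \<mu>)"

lemma supp_graph_inject: "supp_graph g = supp_graph h \<longleftrightarrow> g = h"
proof
  assume eq: "supp_graph g = supp_graph h"
  have "g x = h x" for x
  proof (cases "g x = 0")
    case True
    then have "(x, h x) \<notin> supp_graph g" by (auto simp: supp_graph_def)
    then show ?thesis using True eq by (auto simp: supp_graph_def)
  next
    case False
    then have "(x, g x) \<in> supp_graph h" using eq by (auto simp: supp_graph_def)
    then show ?thesis by (auto simp: supp_graph_def)
  qed
  then show "g = h" by auto
qed simp

lemma iota_new_point:
  fixes \<kappa> :: "'k rel" and g :: "('a, 'k) point \<Rightarrow> real"
  assumes "Card_order \<kappa>" "g \<in> hahn \<kappa> \<Gamma>" "g \<noteq> 0"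
  shows "iota (new_point g) = g"
proof -
  have img: "supp_graph g = (\<lambda>x. (x, g x)) ` supp g"
    by (auto simp: supp_graph_def supp_def)
  have "|supp g| <o \<kappa>" using assms(2) by (simp add: hahn_def)
  moreover have "\<kappa> =o |Field \<kappa>|"
    using assms(1) by (rule ordIso_symmetric[OF card_of_Field_ordIso])
  moreover have "|Field \<kappa>| \<le>o |UNIV :: 'k set|" by (rule card_of_mono1) simp
  ultimately have "|supp g| \<le>o |UNIV :: 'k set|"
    by (meson ordLess_imp_ordLeq ordLeq_ordIso_trans ordLeq_transitive)
  then have le: "|supp_graph g| \<le>o |UNIV :: 'k set|"
    unfolding img by (rule ordLeq_transitive[OF card_of_image])
  have "supp_graph g \<noteq> {}" using assms(3) by (auto simp: supp_graph_def fun_eq_iff)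
  then have "\<exists>s :: 'k \<Rightarrow> _. range s = supp_graph g"
    using le card_of_ordLeq2[of "supp_graph g" "UNIV :: 'k set"] by blast
  then have "range (SOME s :: 'k \<Rightarrow> _. range s = supp_graph g) = supp_graph g"
    by (rule someI_ex)
  then show ?thesis by (simp add: new_point_def supp_graph_inject)
qed

lemma is_pred_unique:
  assumes "Well_order \<kappa>" "is_pred \<kappa> j i" "is_pred \<kappa> k i"
  shows "j = k"
proof -
  have "antisym \<kappa>" using assms(1) by (simp add: order_on_defs)
  moreover have "(j, k) \<in> \<kappa>" "(k, j) \<in> \<kappa>"
    using assms(2,3) by (auto simp: is_pred_def under_def)
  ultimately show ?thesis by (rule antisymD)
qed

lemma power_stage_rec:
  assumes "Well_order \<kappa>"
  shows "power_stage \<kappa> \<Gamma>\<^sub>0 \<mu> =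
    (if underS \<kappa> \<mu> = {} then base_chain \<Gamma>\<^sub>0
     else if \<exists>\<alpha>. is_pred \<kappa> \<alpha> \<mu> then power_step \<kappa> (power_stage \<kappa> \<Gamma>\<^sub>0 (THE \<alpha>. is_pred \<kappa> \<alpha> \<mu>))
     else (\<Union>\<alpha>\<in>underS \<kappa> \<mu>. power_stage \<kappa> \<Gamma>\<^sub>0 \<alpha>))"
proof -
  have pred: "(THE \<alpha>. is_pred \<kappa> \<alpha> i) \<in> underS \<kappa> i" if "\<exists>\<alpha>. is_pred \<kappa> \<alpha> i" for i
  proof -
    have "\<exists>!\<alpha>. is_pred \<kappa> \<alpha> i" using that is_pred_unique[OF assms] by blast
    then have "is_pred \<kappa> (THE \<alpha>. is_pred \<kappa> \<alpha> i) i" by (rule theI')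
    then show ?thesis by (simp add: is_pred_def)
  qed
  let ?H = "\<lambda>\<Gamma> i. if underS \<kappa> i = {} then base_chain \<Gamma>\<^sub>0
    else if \<exists>\<alpha>. is_pred \<kappa> \<alpha> i then power_step \<kappa> (\<Gamma> (THE \<alpha>. is_pred \<kappa> \<alpha> i))
    else (\<Union>\<alpha>\<in>underS \<kappa> i. \<Gamma> \<alpha>)"
  have wo: "wo_rel \<kappa>" using assms by (simp add: wo_rel_def)
  have "wo_rel.adm_wo \<kappa> ?H"
    unfolding wo_rel.adm_wo_def[OF wo] using pred by auto
  then have "wo_rel.worec \<kappa> ?H = ?H (wo_rel.worec \<kappa> ?H)"
    by (rule wo_rel.worec_fixpoint[OF wo])
  then show ?thesis
    unfolding power_stage_def by (rule fun_cong)
qed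

lemma power_stage_zero:
  "Well_order \<kappa> \<Longrightarrow> underS \<kappa> \<mu> = {} \<Longrightarrow> power_stage \<kappa> \<Gamma>\<^sub>0 \<mu> = base_chain \<Gamma>\<^sub>0"
  by (rule trans[OF power_stage_rec]) simp_all

lemma power_stage_succ:
  assumes "Well_order \<kappa>" "is_pred \<kappa> \<alpha> \<mu>"
  shows "power_stage \<kappa> \<Gamma>\<^sub>0 \<mu> = power_step \<kappa> (power_stage \<kappa> \<Gamma>\<^sub>0 \<alpha>)"
proof -
  have "(THE \<alpha>. is_pred \<kappa> \<alpha> \<mu>) = \<alpha>"
    using assms is_pred_unique by (intro the_equality)
  moreover have "underS \<kappa> \<mu> \<noteq> {}" using assms(2) by (auto simp: is_pred_def)
  ultimately show ?thesis using assms(2)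
    by (intro trans[OF power_stage_rec[OF assms(1)]]) auto
qed

lemma power_stage_limit:
  "Well_order \<kappa> \<Longrightarrow> underS \<kappa> \<mu> \<noteq> {} \<Longrightarrow> \<nexists>\<alpha>. is_pred \<kappa> \<alpha> \<mu> \<Longrightarrow>
    power_stage \<kappa> \<Gamma>\<^sub>0 \<mu> = (\<Union>\<alpha>\<in>underS \<kappa> \<mu>. power_stage \<kappa> \<Gamma>\<^sub>0 \<alpha>)"
  by (rule trans[OF power_stage_rec]) simp_all


section \<open>The power series field \<open>\<real>((G))\<^sub>\<kappa>\<close> and its logarithm\<close>

text \<open>
  For \<open>G = (\<real>\<^sup>\<Gamma>)\<^sub>\<kappa>\<close>, ordered by \<^term>\<open>hahn_order \<kappa> \<Gamma>\<close>, the ordered additive group of \<open>\<real>((G))\<^sub>\<kappa>\<close> is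
  \<open>(\<real>\<^sup>G)\<^sub>\<kappa>\<close>, the valuation is \<open>min_supp\<close>, and \<open>t\<^sup>g\<close> is \<^term>\<open>indicator {g}\<close>. The index sets of the
  two sums below are finite for factors with well-ordered support and for summable families.
  The multiplication \<open>*\<close> and power \<open>^\<close> that functions carry pointwise are not those of the field.
\<close>

definition series_mult :: "('g::ab_group_add \<Rightarrow> real) \<Rightarrow> ('g \<Rightarrow> real) \<Rightarrow> 'g \<Rightarrow> real"
  where "series_mult s s' = (\<lambda>g. \<Sum>a | s a \<noteq> 0 \<and> s' (g - a) \<noteq> 0. s a * s' (g - a))"

definition series_power :: "('g::ab_group_add \<Rightarrow> real) \<Rightarrow> nat \<Rightarrow> 'g \<Rightarrow> real"
  where "series_power s n = (series_mult s ^^ n) (indicator {0})"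

definition series_sum :: "'i set \<Rightarrow> ('i \<Rightarrow> 'g \<Rightarrow> real) \<Rightarrow> 'g \<Rightarrow> real"
  where "series_sum I F = (\<lambda>g. \<Sum>i | i \<in> I \<and> F i g \<noteq> 0. F i g)"

definition series_order :: "'k rel \<Rightarrow> 'c rel \<Rightarrow> (('c \<Rightarrow> real) \<Rightarrow> real) rel"
  where "series_order \<kappa> \<Gamma> = hahn_order \<kappa> (hahn_order \<kappa> \<Gamma>)"

definition series_field :: "'k rel \<Rightarrow> 'c rel \<Rightarrow> (('c \<Rightarrow> real) \<Rightarrow> real) set"
  where "series_field \<kappa> \<Gamma> = hahn \<kappa> (hahn_order \<kappa> \<Gamma>)"

definition valuation :: "'k rel \<Rightarrow> 'c rel \<Rightarrow> (('c \<Rightarrow> real) \<Rightarrow> real) \<Rightarrow> 'c \<Rightarrow> real"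
  where "valuation \<kappa> \<Gamma> s = min_supp (hahn_order \<kappa> \<Gamma>) s"

definition valuation_ring :: "'k rel \<Rightarrow> 'c rel \<Rightarrow> (('c \<Rightarrow> real) \<Rightarrow> real) set"
  where "valuation_ring \<kappa> \<Gamma> =
    {s \<in> series_field \<kappa> \<Gamma>. s = 0 \<or> (0, valuation \<kappa> \<Gamma> s) \<in> hahn_order \<kappa> \<Gamma>}"

definition infinitesimals :: "'k rel \<Rightarrow> 'c rel \<Rightarrow> (('c \<Rightarrow> real) \<Rightarrow> real) set"
  where "infinitesimals \<kappa> \<Gamma> =
    {s \<in> series_field \<kappa> \<Gamma>. s = 0 \<or>
       (0, valuation \<kappa> \<Gamma> s) \<in> hahn_order \<kappa> \<Gamma> \<and> valuation \<kappa> \<Gamma> s \<noteq> 0}"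

definition series_log ::
    "'k rel \<Rightarrow> 'c rel \<Rightarrow> ('c \<Rightarrow> 'c \<Rightarrow> real) \<Rightarrow> (('c \<Rightarrow> real) \<Rightarrow> real) \<Rightarrow> ('c \<Rightarrow> real) \<Rightarrow> real"
  where "series_log \<kappa> \<Gamma> l a = (THE b. \<exists>g r \<epsilon>.
    g \<in> hahn \<kappa> \<Gamma> \<and> r > 0 \<and> \<epsilon> \<in> infinitesimals \<kappa> \<Gamma> \<and>
    a = series_mult (\<lambda>h. r * indicator {g} h) (indicator {0} + \<epsilon>) \<and>
    b = series_sum (Field \<Gamma>) (\<lambda>\<gamma> h. - g \<gamma> * indicator {l \<gamma>} h)
        + (\<lambda>h. ln r * indicator {0} h)
        + series_sum {1..} (\<lambda>i h. (-1) ^ (i - 1) * series_power \<epsilon> i h / real i))"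


section \<open>Ranks\<close>

definition same_order_type :: "'a rel \<Rightarrow> 'b rel \<Rightarrow> bool"
  where "same_order_type r r' \<longleftrightarrow> (\<exists>f. iso r r' f)"

definition quotient_chain :: "'a rel \<Rightarrow> 'a rel \<Rightarrow> 'a set rel"
  where "quotient_chain r E =
    {(A, B). A \<in> Field r // E \<and> B \<in> Field r // E \<and> (\<exists>a\<in>A. \<exists>b\<in>B. (a, b) \<in> r)}"

definition shift_equiv :: "'a rel \<Rightarrow> ('a \<Rightarrow> 'a) \<Rightarrow> 'a rel"
  where "shift_equiv \<Gamma> \<tau> =
    {(x, y) \<in> Field \<Gamma> \<times> Field \<Gamma>. \<exists>n. (y, (\<tau> ^^ n) x) \<in> \<Gamma> \<and> (x, (\<tau> ^^ n) y) \<in> \<Gamma>}"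

definition shift_rank :: "'a rel \<Rightarrow> ('a \<Rightarrow> 'a) \<Rightarrow> 'a set rel"
  where "shift_rank \<Gamma> \<tau> = quotient_chain \<Gamma> (shift_equiv \<Gamma> \<tau>)"

definition infinite_elements :: "'k rel \<Rightarrow> 'c rel \<Rightarrow> (('c \<Rightarrow> real) \<Rightarrow> real) set"
  where "infinite_elements \<kappa> \<Gamma> =
    {a. (0, a) \<in> series_order \<kappa> \<Gamma> \<and> a \<noteq> 0} - valuation_ring \<kappa> \<Gamma>"

definition log_equiv ::
    "'k rel \<Rightarrow> 'c rel \<Rightarrow> ((('c \<Rightarrow> real) \<Rightarrow> real) \<Rightarrow> ('c \<Rightarrow> real) \<Rightarrow> real) \<Rightarrow> (('c \<Rightarrow> real) \<Rightarrow> real) rel"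
  where "log_equiv \<kappa> \<Gamma> lg =
    {(a, a') \<in> infinite_elements \<kappa> \<Gamma> \<times> infinite_elements \<kappa> \<Gamma>.
       \<exists>n. ((lg ^^ n) a, a') \<in> series_order \<kappa> \<Gamma> \<and> ((lg ^^ n) a', a) \<in> series_order \<kappa> \<Gamma>}"

text \<open>
  The classes are ordered as valuations are: the class of \<open>a\<close> precedes that of \<open>a'\<close> iff
  \<open>v(a) \<le> v(a')\<close> for some representatives, i.e. the class of the larger series comes first. Hence the
  converse of the order induced by \<open>\<real>((G))\<^sub>\<kappa>\<close>. With the induced order itself the logarithmic rank
  would be the reverse of the rank of \<open>(\<Gamma>\<^sub>0, \<sigma>\<^sub>0)\<close>: if \<open>\<gamma> < \<delta>\<close> in \<open>\<Gamma>\<^sub>0\<close>, then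
  \<open>-1\<^sub>\<gamma> < -1\<^sub>\<delta>\<close> in \<open>G\<close>, but the series \<open>t\<^sup>g\<close> with \<open>g = -1\<^sub>\<gamma>\<close> is larger than the one with
  \<open>g = -1\<^sub>\<delta>\<close>.
\<close>

definition log_rank ::
    "'k rel \<Rightarrow> 'c rel \<Rightarrow> ((('c \<Rightarrow> real) \<Rightarrow> real) \<Rightarrow> ('c \<Rightarrow> real) \<Rightarrow> real) \<Rightarrow> (('c \<Rightarrow> real) \<Rightarrow> real) set rel"
  where "log_rank \<kappa> \<Gamma> lg =
    (quotient_chain (Restr (series_order \<kappa> \<Gamma>) (infinite_elements \<kappa> \<Gamma>)) (log_equiv \<kappa> \<Gamma> lg))\<inverse>"

end

theory Submission
  imports Defs
begin

text \<open>
  For an infinite \<open>a\<close> put \<open>p a = min (supp (v a)) \<in> \<Gamma>\<^sub>\<kappa>\<close>. The leading term of \<open>log a\<close> has exponent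
  \<open>\<iota> (\<sigma> (p a))\<close>, so \<open>p (log a) = \<theta> (p a)\<close> for the weakly monotone map
  \<open>\<theta> \<gamma> = min (supp (\<iota> (\<sigma> \<gamma>)))\<close> of \<open>\<Gamma>\<^sub>\<kappa>\<close>, and logarithmic equivalence of \<open>a\<close> and \<open>a'\<close> becomes
  \<open>\<theta>\<close>-equivalence of \<open>p a\<close> and \<open>p a'\<close>. On \<open>\<Gamma>\<^sub>0\<close> the map \<open>\<theta>\<close> agrees with \<open>\<sigma>\<close>, while off \<open>\<Gamma>\<^sub>0\<close> it
  lowers the stage; hence every \<open>\<theta>\<close>-orbit reaches \<open>\<Gamma>\<^sub>0\<close> after finitely many steps. It follows that \<open>\<theta>\<close>
  moves every point upwards and that each class meets \<open>\<Gamma>\<^sub>0\<close> in exactly one class of \<open>\<sigma>\<^sub>0\<close>.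
  That \<open>log a\<close> lies in the field at all is Neumann's lemma.
\<close>

section \<open>Well-ordered subsets of a chain\<close>

text \<open>Orbits reach the base in finitely many steps because a point first appears at the zero
  stage or at a successor stage: in the latter case \<open>\<theta>\<close> leads to a strictly
  smaller ordinal, and ordinals admit no infinite descent. The obstacle is the loss of information
  in p. Passing to a leading index makes \<open>\<theta>\<close> only weakly monotone although
  \<sigma> is an automorphism, so orbit equivalence has to be treated for monotone maps. Likewise p
  a = p b does not tell which of a and b is larger. The strict increase of \<open>\<theta>\<close>
  repairs this: one further logarithm separates the leading indices and thereby decides the order of
  the series. A larger series has a smaller or equal leading index, so p reverses the order; this is
  the converse in \<open>log_rank\<close>. In the other direction the monomials with exponent
  \<open>-1\<^sub>\<gamma>\<close>, for \<gamma> in the base, form a section of p. A base point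
  representing the class of a is found on the orbit of p a itself, at the place where the orbit
  enters the base.\<close>

definition wo_subset :: "'a rel \<Rightarrow> 'a set \<Rightarrow> bool"
  where "wo_subset D S \<longleftrightarrow>
    S \<subseteq> Field D \<and> (\<forall>T\<subseteq>S. T \<noteq> {} \<longrightarrow> (\<exists>m\<in>T. \<forall>x\<in>T. (m, x) \<in> D))"

locale linear_chain =
  fixes D :: "'a rel"
  assumes linear: "Linear_order D"
begin

lemma refl: "x \<in> Field D \<Longrightarrow> (x, x) \<in> D"
  using linear by (auto simp: order_on_defs refl_on_def)

lemma trans: "(x, y) \<in> D \<Longrightarrow> (y, z) \<in> D \<Longrightarrow> (x, z) \<in> D"
  using linear by (auto simp: order_on_defs dest: transD)

lemma antisym: "(x, y) \<in> D \<Longrightarrow> (y, x) \<in> D \<Longrightarrow> x = y"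
  using linear by (auto simp: order_on_defs dest: antisymD)

lemma total: "x \<in> Field D \<Longrightarrow> y \<in> Field D \<Longrightarrow> (x, y) \<in> D \<or> (y, x) \<in> D"
  using linear refl by (cases "x = y") (auto simp: order_on_defs total_on_def)

text \<open>Totality turns a minimal element into a least one, antisymmetry gives the way back. The
  least-element form replaces the well-foundedness hidden in \<open>hahn\<close>, because it passes
  directly to subsets, unions and monotone images.\<close>

lemma well_order_on_Restr_iff:
  assumes "S \<subseteq> Field D"
  shows "well_order_on S (Restr D S) \<longleftrightarrow> wo_subset D S"
proof
  assume wo: "well_order_on S (Restr D S)"
  have "\<exists>m\<in>T. \<forall>x\<in>T. (m, x) \<in> D" if T: "T \<subseteq> S" "T \<noteq> {}" for T
  proof -
    have "wf (Restr D S - Id)" using wo by (simp add: well_order_on_def)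
    then obtain m where m: "m \<in> T" "\<And>y. (y, m) \<in> Restr D S - Id \<Longrightarrow> y \<notin> T"
      using T(2) by (meson ex_in_conv wfE_min)
    have "(m, x) \<in> D" if "x \<in> T" for x
      using total[of m x] refl[of m] m that T(1) assms by blast
    then show ?thesis using m(1) by blast
  qed
  then show "wo_subset D S" using assms by (auto simp: wo_subset_def)
next
  assume wo: "wo_subset D S"
  have F: "Field (Restr D S) = S"
    using assms linear by (simp add: Refl_Field_Restr2 order_on_defs)
  have "wf (Restr D S - Id)"
  proof (rule wfI_min)
    fix x Q assume "x \<in> (Q :: 'a set)"
    show "\<exists>z\<in>Q. \<forall>y. (y, z) \<in> Restr D S - Id \<longrightarrow> y \<notin> Q"
    proof (cases "Q \<inter> S = {}")
      case True
      then show ?thesis using \<open>x \<in> Q\<close> by blast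
    next
      case False
      then obtain m where m: "m \<in> Q \<inter> S" "\<forall>x\<in>Q \<inter> S. (m, x) \<in> D"
        using wo[unfolded wo_subset_def, THEN conjunct2, rule_format, of "Q \<inter> S"] by blast
      have "y \<notin> Q" if "(y, m) \<in> Restr D S - Id" for y
        using that m(2) antisym[of m y] by auto
      then show ?thesis using m(1) by blast
    qed
  qed
  moreover have "linear_order_on S (Restr D S)"
    using Linear_order_Restr[OF linear, of S] by (simp add: F)
  ultimately show "well_order_on S (Restr D S)" by (simp add: well_order_on_def)
qed

lemma wo_subset_mono: "wo_subset D S \<Longrightarrow> T \<subseteq> S \<Longrightarrow> wo_subset D T"
  by (meson order_trans wo_subset_def)

lemma wo_subset_min:
  assumes "wo_subset D S" "S \<noteq> {}"
  obtains m where "m \<in> S" "\<And>x. x \<in> S \<Longrightarrow> (m, x) \<in> D"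
proof -
  have "\<exists>m\<in>S. \<forall>x\<in>S. (m, x) \<in> D"
    using assms(1)[unfolded wo_subset_def, THEN conjunct2, rule_format, of S] assms(2) by simp
  then show ?thesis using that by auto
qed

lemma wo_subset_Un:
  assumes "wo_subset D S" "wo_subset D T"
  shows "wo_subset D (S \<union> T)"
  unfolding wo_subset_def
proof (intro conjI allI impI)
  show "S \<union> T \<subseteq> Field D" using assms by (auto simp: wo_subset_def)
  fix U assume U: "U \<subseteq> S \<union> T" "U \<noteq> {}"
  show "\<exists>m\<in>U. \<forall>x\<in>U. (m, x) \<in> D"
  proof (cases "U \<inter> S = {} \<or> U \<inter> T = {}")
    case True
    then have "U \<subseteq> S \<or> U \<subseteq> T" using U by blast
    then show ?thesis using U assms unfolding wo_subset_def by meson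
  next
    case False
    obtain m where m: "m \<in> U \<inter> S" "\<And>x. x \<in> U \<inter> S \<Longrightarrow> (m, x) \<in> D"
      using wo_subset_min[OF wo_subset_mono[OF assms(1), of "U \<inter> S"]] False by blast
    obtain n where n: "n \<in> U \<inter> T" "\<And>x. x \<in> U \<inter> T \<Longrightarrow> (n, x) \<in> D"
      using wo_subset_min[OF wo_subset_mono[OF assms(2), of "U \<inter> T"]] False by blast
    have "m \<in> Field D" "n \<in> Field D" using m(1) n(1) assms by (auto simp: wo_subset_def)
    then consider "(m, n) \<in> D" | "(n, m) \<in> D" using total by blast
    then show ?thesis
    proof cases
      case 1
      then have "(m, x) \<in> D" if "x \<in> U" for x
        using m(2)[of x] n(2)[of x] trans[OF 1, of x] that U(1) by blast
      then show ?thesis using m(1) by blast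
    next
      case 2
      then have "(n, x) \<in> D" if "x \<in> U" for x
        using m(2)[of x] n(2)[of x] trans[OF 2, of x] that U(1) by blast
      then show ?thesis using n(1) by blast
    qed
  qed
qed

lemma wo_subset_singleton: "x \<in> Field D \<Longrightarrow> wo_subset D {x}"
  using refl by (auto simp: wo_subset_def dest!: subset_singletonD)

text \<open>A least point of the preimage of T is sent to a least point of T. The target may be
  another chain: the lemma serves both translations inside G and the passage from a support in
  \<Gamma> to exponents in G.\<close>

lemma wo_subset_image:
  assumes "wo_subset D S" "f ` S \<subseteq> Field E"
    and "\<And>x y. x \<in> S \<Longrightarrow> y \<in> S \<Longrightarrow> (x, y) \<in> D \<Longrightarrow> (f x, f y) \<in> E"
  shows "wo_subset E (f ` S)"
  unfolding wo_subset_def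
proof (intro conjI allI impI)
  fix T assume T: "T \<subseteq> f ` S" "T \<noteq> {}"
  then have "{x \<in> S. f x \<in> T} \<noteq> {}" by blast
  then obtain m where "m \<in> {x \<in> S. f x \<in> T}" "\<And>x. x \<in> {x \<in> S. f x \<in> T} \<Longrightarrow> (m, x) \<in> D"
    using wo_subset_min[OF wo_subset_mono[OF assms(1), of "{x \<in> S. f x \<in> T}"]] by blast
  then show "\<exists>m\<in>T. \<forall>x\<in>T. (m, x) \<in> E" using T(1) assms(3) by (intro bexI[of _ "f m"]) auto
qed (rule assms(2))

text \<open>The index \<open>k n\<close> is chosen so that \<open>s (k n)\<close> is least among all
  later terms of s; every later choice then continues the subsequence automatically.\<close>

lemma nondecreasing_subsequence:
  assumes "wo_subset D S" "\<And>i :: nat. s i \<in> S"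
  obtains k :: "nat \<Rightarrow> nat" where "\<And>n. k n < k (Suc n)" "\<And>n. (s (k n), s (k (Suc n))) \<in> D"
proof -
  have ex: "\<exists>j\<ge>i. \<forall>l\<ge>i. (s j, s l) \<in> D" for i
  proof -
    have "s ` {i..} \<subseteq> S" using assms(2) by blast
    then obtain m where "m \<in> s ` {i..}" "\<And>x. x \<in> s ` {i..} \<Longrightarrow> (m, x) \<in> D"
      using wo_subset_min[OF wo_subset_mono[OF assms(1)], of "s ` {i..}"] by blast
    then show ?thesis by auto
  qed
  have "\<exists>k. \<forall>n. (\<forall>l\<ge>k n. (s (k n), s l) \<in> D) \<and> k n < k (Suc n)"
  proof (rule dependent_nat_choice)
    show "\<exists>x. \<forall>l\<ge>x. (s x, s l) \<in> D" using ex by (meson order_trans)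
  next
    fix x show "\<exists>y. (\<forall>l\<ge>y. (s y, s l) \<in> D) \<and> x < y"
      using ex[of "Suc x"] by (meson Suc_le_eq order_trans)
  qed
  then show ?thesis using that by (meson less_imp_le)
qed

end


section \<open>Neumann's lemma\<close>

text \<open>The union over n is the submonoid generated by S. The number of summands is kept as an
  index because it bounds the support of the n-th power of a series and serves as the length in the
  minimal bad sequence.\<close>

primrec nfold_sums :: "nat \<Rightarrow> 'g::ab_group_add set \<Rightarrow> 'g set"
  where
    "nfold_sums 0 S = {0}"
  | "nfold_sums (Suc n) S = {a + b | a b. a \<in> S \<and> b \<in> nfold_sums n S}"

text \<open>Addition is that of the ambient type, while the order lives on \<open>Field D\<close>
  and depends on \<kappa> and on the underlying chain, so it is carried as a relation. The locale is
  used twice: for the value group G and for the additive group of the series field over it.\<close>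

locale group_chain = linear_chain D for D :: "'g::ab_group_add rel" +
  assumes zero_Field: "0 \<in> Field D"
    and add_Field: "x \<in> Field D \<Longrightarrow> y \<in> Field D \<Longrightarrow> x + y \<in> Field D"
    and uminus_Field: "x \<in> Field D \<Longrightarrow> - x \<in> Field D"
    and add_mono: "(x, y) \<in> D \<Longrightarrow> z \<in> Field D \<Longrightarrow> (x + z, y + z) \<in> D"
begin

abbreviation less (infix "\<sqsubset>" 50)
  where "x \<sqsubset> y \<equiv> (x, y) \<in> D \<and> x \<noteq> y"

lemma less_trans: "x \<sqsubset> y \<Longrightarrow> y \<sqsubset> z \<Longrightarrow> x \<sqsubset> z"
  using trans[of x y z] antisym[of x y] by blast

lemma le_less_trans: "(x, y) \<in> D \<Longrightarrow> y \<sqsubset> z \<Longrightarrow> x \<sqsubset> z"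
  using trans[of x y z] antisym[of x y] by blast

lemma less_le_trans: "x \<sqsubset> y \<Longrightarrow> (y, z) \<in> D \<Longrightarrow> x \<sqsubset> z"
  using trans[of x y z] antisym[of x y] by blast

lemma diff_Field: "x \<in> Field D \<Longrightarrow> y \<in> Field D \<Longrightarrow> x - y \<in> Field D"
  using add_Field[OF _ uminus_Field] by simp

lemma diff_mono: "(x, y) \<in> D \<Longrightarrow> z \<in> Field D \<Longrightarrow> (x - z, y - z) \<in> D"
  using add_mono[OF _ uminus_Field] by simp

lemma nfold_sums_pos:
  assumes S: "S \<subseteq> Field D" "\<And>s. s \<in> S \<Longrightarrow> 0 \<sqsubset> s"
  shows "x \<in> nfold_sums n S \<Longrightarrow> (0, x) \<in> D \<and> (n > 0 \<longrightarrow> x \<noteq> 0)"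
proof (induction n arbitrary: x)
  case 0
  then show ?case using refl zero_Field by simp
next
  case (Suc n)
  then obtain a b where ab: "x = a + b" "a \<in> S" "b \<in> nfold_sums n S" by auto
  have b: "(0, b) \<in> D" using Suc.IH ab(3) by blast
  then have "(0 + a, b + a) \<in> D" using ab(2) S(1) by (intro add_mono) auto
  then have "(a, x) \<in> D" using ab(1) by (simp add: add.commute)
  then show ?case using less_le_trans[OF S(2)[OF ab(2)]] by blast
qed

text \<open>A minimal bad sequence argument in the style of Nash-Williams. Split each term as
  \<open>x n = s n + y n\<close> with \<open>s n\<close> in S. Along a subsequence on which the
  first summands do not decrease, the remainders must strictly decrease, and they are shorter than
  the terms they come from, against minimality.\<close>

lemma wo_subset_nfold_sums:
  assumes wo: "wo_subset D S" and pos: "\<And>s. s \<in> S \<Longrightarrow> 0 \<sqsubset> s"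
  shows "wo_subset D (\<Union>n. nfold_sums n S)"
proof -
  let ?M = "\<Union>n. nfold_sums n S"
  have SF: "S \<subseteq> Field D" using wo by (simp add: wo_subset_def)
  note M_pos = nfold_sums_pos[OF SF pos]
  have MF: "?M \<subseteq> Field D" using M_pos by (auto intro: FieldI2)
  define R where "R = {(x, y). x \<in> ?M \<and> y \<in> ?M \<and> x \<sqsubset> y}"
  define bad where "bad x \<longleftrightarrow> (\<exists>f. f 0 = x \<and> (\<forall>i :: nat. (f (Suc i), f i) \<in> R))" for x
  \<comment> \<open>The same element may be a sum of S-elements in several numbers of summands,
    hence the least such number.\<close>
  define len where "len x = (LEAST n. x \<in> nfold_sums n S)" for x
  have len: "x \<in> nfold_sums (len x) S" if "x \<in> ?M" for x
    using that unfolding len_def by (auto intro: LeastI)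
  have bad_step: "\<exists>y. bad y \<and> (y, x) \<in> R" if x: "bad x" for x
  proof -
    obtain f where f: "f 0 = x" "\<forall>i :: nat. (f (Suc i), f i) \<in> R" using x bad_def by auto
    have "bad (f (Suc 0))"
      unfolding bad_def by (rule exI[of _ "\<lambda>i. f (Suc i)"]) (use f in simp)
    then show ?thesis using f by force
  qed
  have "wf R"
  proof (rule ccontr)
    assume "\<not> wf R"
    then have ex_bad: "\<exists>x. bad x"
      unfolding wf_iff_no_infinite_down_chain bad_def by blast
    have min_len: "\<exists>x. P x \<and> (\<forall>y. P y \<longrightarrow> len x \<le> len y)" if "\<exists>x. P x" for P
      using ex_has_least_nat[of P _ len] that by blast
    \<comment> \<open>a minimal bad sequence: each term has least length among the possible continuations\<close>
    have "\<exists>x. \<forall>n. (bad (x n) \<and> (n = 0 \<longrightarrow> (\<forall>y. bad y \<longrightarrow> len (x n) \<le> len y))) \<and>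
      ((x (Suc n), x n) \<in> R \<and>
       (\<forall>y. bad y \<and> (y, x n) \<in> R \<longrightarrow> len (x (Suc n)) \<le> len y))"
    proof (rule dependent_nat_choice)
      show "\<exists>x. bad x \<and> (0 = (0 :: nat) \<longrightarrow> (\<forall>y. bad y \<longrightarrow> len x \<le> len y))"
        using min_len[OF ex_bad] by simp
    next
      fix x and n :: nat
      assume "bad x \<and> (n = 0 \<longrightarrow> (\<forall>y. bad y \<longrightarrow> len x \<le> len y))"
      then show "\<exists>y. (bad y \<and> (Suc n = 0 \<longrightarrow> (\<forall>z. bad z \<longrightarrow> len y \<le> len z))) \<and>
          ((y, x) \<in> R \<and> (\<forall>z. bad z \<and> (z, x) \<in> R \<longrightarrow> len y \<le> len z))"
        using min_len[OF bad_step[of x]] by auto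
    qed
    then obtain x where x: "\<forall>n. (bad (x n) \<and> (n = 0 \<longrightarrow> (\<forall>y. bad y \<longrightarrow> len (x n) \<le> len y))) \<and>
      ((x (Suc n), x n) \<in> R \<and>
       (\<forall>y. bad y \<and> (y, x n) \<in> R \<longrightarrow> len (x (Suc n)) \<le> len y))"
      by (rule exE)
    have x0: "len (x 0) \<le> len y" if "bad y" for y
      using x[THEN spec, of 0] that by blast
    have x_dec: "(x (Suc n), x n) \<in> R" for n
      using x[THEN spec, of n] by blast
    have x_min: "len (x (Suc n)) \<le> len y" if "bad y" "(y, x n) \<in> R" for n y
      using x[THEN spec, of n] that by blast
    have x_M: "x n \<in> ?M" for n using x_dec[of n] by (simp add: R_def)
    have x_less: "i < j \<Longrightarrow> x j \<sqsubset> x i" for i j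
    proof (induction j)
      case (Suc j)
      have "x (Suc j) \<sqsubset> x j" using x_dec[of j] by (simp add: R_def)
      moreover have "i = j \<or> x j \<sqsubset> x i" using Suc by auto
      ultimately show ?case using less_trans[of "x (Suc j)" "x j" "x i"] by metis
    qed simp
    have "\<exists>s y. x n = s + y \<and> s \<in> S \<and> y \<in> nfold_sums (len (x n) - 1) S \<and> len (x n) > 0" for n
    proof -
      \<comment> \<open>Zero is the least element of \<open>?M\<close>, so nothing in the sequence
        could come below it. Being nonzero, \<open>x n\<close> has positive length and a first
        summand can be split off.\<close>
      have "x n \<noteq> 0"
      proof
        assume "x n = 0"
        then have "x (Suc n) \<sqsubset> 0" using x_less[of n "Suc n"] by simp
        moreover have "(0, x (Suc n)) \<in> D" using x_M[of "Suc n"] M_pos by blast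
        ultimately show False using antisym[of 0 "x (Suc n)"] by auto
      qed
      then have "len (x n) \<noteq> 0" using len[OF x_M[of n]] by (cases "len (x n)") auto
      then obtain p where p: "len (x n) = Suc p" using not0_implies_Suc by blast
      show ?thesis using len[OF x_M[of n]] unfolding p by auto
    qed
    then obtain s y where sy: "\<And>n. x n = s n + y n" "\<And>n. s n \<in> S"
        "\<And>n. y n \<in> nfold_sums (len (x n) - 1) S" "\<And>n. len (x n) > 0" by metis
    obtain k :: "nat \<Rightarrow> nat" where k: "\<And>n. k n < k (Suc n)" "\<And>n. (s (k n), s (k (Suc n))) \<in> D"
      using nondecreasing_subsequence[OF wo, of s] sy(2) by blast
    have y_M: "y n \<in> ?M" for n using sy(3) by blast
    have xF: "x n \<in> Field D" and yF: "y n \<in> Field D" and sF: "s n \<in> Field D" for n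
      using x_M[of n] y_M[of n] sy(2)[of n] MF SF by auto
    \<comment> \<open>With i and j consecutive values of k, \<open>s i \<le> s j\<close> gives y j =
      x j - s j \<le> x j - s i < x i - s i = y i.\<close>
    have y_dec: "y (k (Suc n)) \<sqsubset> y (k n)" for n
    proof -
      let ?i = "k n" and ?j = "k (Suc n)"
      have x: "x ?j \<sqsubset> x ?i" using x_less k(1) by blast
      have yx: "x ?i - s ?i = y ?i" "x ?j - s ?j = y ?j" by (simp_all add: sy(1))
      have "(x ?j - s ?i, x ?i - s ?i) \<in> D" using diff_mono x sF by blast
      then have 1: "x ?j - s ?i \<sqsubset> y ?i" using x yx by (metis diff_left_imp_eq diff_add_cancel)
      have "(s ?i + (y ?j - s ?i), s ?j + (y ?j - s ?i)) \<in> D"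
        using k(2) diff_Field yF sF by (intro add_mono) auto
      then have "(y ?j, x ?j - s ?i) \<in> D" by (simp add: sy(1) algebra_simps)
      then show ?thesis using 1 by (rule le_less_trans)
    qed
    have y_bad: "bad (y (k 0))"
      unfolding bad_def R_def by (rule exI[of _ "\<lambda>i. y (k i)"]) (use y_dec y_M in auto)
    have len_y: "len (y n) < len (x n)" for n
    proof -
      have "len (y n) \<le> len (x n) - 1" unfolding len_def[of "y n"] by (rule Least_le) (rule sy(3))
      then show ?thesis using sy(4)[of n] by linarith
    qed
    have y_less: "y n \<sqsubset> x n" for n
    proof -
      have "(0 + y n, s n + y n) \<in> D" using pos[OF sy(2)] yF add_mono by blast
      then show ?thesis using pos[OF sy(2), of n] sy(1)[of n] by auto
    qed
    \<comment> \<open>The term \<open>x (k 0)\<close> was chosen of least length among all bad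
      elements if \<open>k 0 = 0\<close>, and otherwise among the bad elements below its
      predecessor. In both cases the shorter \<open>y (k 0)\<close> was also a candidate.\<close>
    show False
    proof (cases "k 0")
      case 0
      then show ?thesis using x0[OF y_bad] len_y[of "k 0"] by simp
    next
      case (Suc j)
      then have "y (k 0) \<sqsubset> x j"
        using less_trans[OF y_less[of "k 0"] x_less[of j "k 0"]] by simp
      then have "(y (k 0), x j) \<in> R" using x_M y_M by (auto simp: R_def)
      then show ?thesis using x_min[OF y_bad] len_y[of "k 0"] Suc by (metis not_le)
    qed
  qed
  have "\<exists>m\<in>T. \<forall>x\<in>T. (m, x) \<in> D" if T: "T \<subseteq> ?M" "T \<noteq> {}" for T
  proof -
    obtain m where m: "m \<in> T" "\<And>y. (y, m) \<in> R \<Longrightarrow> y \<notin> T"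
      using \<open>wf R\<close> T(2) by (meson ex_in_conv wfE_min)
    have "(m, x) \<in> D" if x: "x \<in> T" for x
    proof -
      have "x \<in> Field D" "m \<in> Field D" using x m(1) T(1) MF by auto
      then show ?thesis
        using total[of x m] m(1) m(2)[of x] x T(1) unfolding R_def by blast
    qed
    then show ?thesis using m(1) by blast
  qed
  then show ?thesis using MF by (simp add: wo_subset_def)
qed

end

section \<open>Hahn groups\<close>

lemma supp_add: "supp (g + h) \<subseteq> supp g \<union> supp h"
  and supp_uminus [simp]: "supp (- g) = supp g"
  and supp_diff: "supp (g - h) \<subseteq> supp g \<union> supp h"
  and supp_zero [simp]: "supp (0 :: 'a \<Rightarrow> real) = {}"
  by (auto simp: supp_def)

lemma supp_eq_empty_iff [simp]: "supp g = {} \<longleftrightarrow> g = 0"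
  by (auto simp: supp_def fun_eq_iff)

lemma finite_ordLess_Card_order:
  "Card_order \<kappa> \<Longrightarrow> natLeq <o \<kappa> \<Longrightarrow> finite A \<Longrightarrow> |A| <o \<kappa>"
  using finite_iff_ordLess_natLeq ordLess_transitive by blast

lemma Cinfinite_of_natLeq:
  assumes "Card_order \<kappa>" "natLeq <o \<kappa>"
  shows "Cinfinite \<kappa>"
  using assms infinite_iff_natLeq_ordLeq[of "Field \<kappa>"] card_of_Field_ordIso ordIso_symmetric
    ordLeq_ordIso_trans ordLess_imp_ordLeq
  unfolding cinfinite_def by blast

text \<open>Lexicographic order through a witness for the first place of difference instead of
  \<open>min_supp\<close> of a difference. Translation invariance becomes a pointwise fact and
  transitivity a comparison of two witnesses.\<close>

definition hahn_less :: "'a rel \<Rightarrow> ('a \<Rightarrow> real) \<Rightarrow> ('a \<Rightarrow> real) \<Rightarrow> bool"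
  where "hahn_less D g h \<longleftrightarrow>
    (\<exists>m\<in>Field D. g m < h m \<and> (\<forall>x. (x, m) \<in> D \<and> x \<noteq> m \<longrightarrow> g x = h x))"

context linear_chain
begin

lemma hahn_iff:
  "g \<in> hahn \<kappa> D \<longleftrightarrow> wo_subset D (supp g) \<and> |supp g| <o \<kappa>"
  using well_order_on_Restr_iff[of "supp g"] by (auto simp: hahn_def wo_subset_def)

lemma hahn_wo_subset: "g \<in> hahn \<kappa> D \<Longrightarrow> wo_subset D (supp g)"
  by (simp add: hahn_iff)

lemma min_supp_eqI:
  "m \<in> supp g \<Longrightarrow> (\<And>x. x \<in> supp g \<Longrightarrow> (m, x) \<in> D) \<Longrightarrow> min_supp D g = m"
  unfolding min_supp_def using antisym by (intro the_equality) blast+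

lemma min_supp_wo:
  assumes "wo_subset D (supp g)" "g \<noteq> 0"
  shows "min_supp D g \<in> supp g" "\<And>x. x \<in> supp g \<Longrightarrow> (min_supp D g, x) \<in> D"
proof -
  obtain m where "m \<in> supp g" "\<And>x. x \<in> supp g \<Longrightarrow> (m, x) \<in> D"
    using wo_subset_min[OF assms(1)] assms(2) by (metis supp_eq_empty_iff)
  moreover from this have "min_supp D g = m" by (rule min_supp_eqI)
  ultimately show "min_supp D g \<in> supp g" "\<And>x. x \<in> supp g \<Longrightarrow> (min_supp D g, x) \<in> D"
    by simp_all
qed

lemmas min_supp_hahn = min_supp_wo[OF hahn_wo_subset]

lemma min_supp_Field: "g \<in> hahn \<kappa> D \<Longrightarrow> g \<noteq> 0 \<Longrightarrow> min_supp D g \<in> Field D"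
  using min_supp_hahn(1) by (auto simp: hahn_def)

lemma lex_pos_diff_iff:
  assumes "wo_subset D (supp g)" "wo_subset D (supp h)"
  shows "lex_pos D (h - g) \<longleftrightarrow> hahn_less D g h"
proof
  have wo: "wo_subset D (supp (h - g))"
    using wo_subset_mono[OF wo_subset_Un[OF assms(2,1)] supp_diff] .
  show "hahn_less D g h" if "lex_pos D (h - g)"
  proof -
    let ?m = "min_supp D (h - g)"
    have nz: "h - g \<noteq> 0" and pos: "g ?m < h ?m" using that by (auto simp: lex_pos_def)
    note m = min_supp_wo[OF wo nz]
    have "?m \<in> Field D" using m(1) wo by (auto simp: wo_subset_def)
    moreover have "g x = h x" if "(x, ?m) \<in> D" "x \<noteq> ?m" for x
    proof (rule ccontr)
      assume "g x \<noteq> h x"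
      then have "(?m, x) \<in> D" by (intro m(2)) (simp add: supp_def)
      then show False using that antisym by blast
    qed
    ultimately show ?thesis using pos unfolding hahn_less_def by blast
  qed
  show "lex_pos D (h - g)" if "hahn_less D g h"
  proof -
    obtain m where m: "m \<in> Field D" "g m < h m" "\<And>x. (x, m) \<in> D \<Longrightarrow> x \<noteq> m \<Longrightarrow> g x = h x"
      using \<open>hahn_less D g h\<close> unfolding hahn_less_def by blast
    have "min_supp D (h - g) = m"
    proof (rule min_supp_eqI)
      show "m \<in> supp (h - g)" using m(2) by (simp add: supp_def)
      fix x assume "x \<in> supp (h - g)"
      then have "g x \<noteq> h x" "x \<in> Field D" using wo by (auto simp: supp_def wo_subset_def)
      then show "(m, x) \<in> D" using m(1,3) total refl by blast
    qed
    moreover have "h - g \<noteq> 0" using m(2) by (metis diff_self eq_iff_diff_eq_0 less_irrefl)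
    ultimately show ?thesis using m(2) by (simp add: lex_pos_def)
  qed
qed

lemma hahn_order_iff:
  "(g, h) \<in> hahn_order \<kappa> D \<longleftrightarrow>
    g \<in> hahn \<kappa> D \<and> h \<in> hahn \<kappa> D \<and> (g = h \<or> hahn_less D g h)"
  using lex_pos_diff_iff[OF hahn_wo_subset hahn_wo_subset] by (auto simp: hahn_order_def)

lemma hahn_less_trans:
  assumes "hahn_less D f g" "hahn_less D g h"
  shows "hahn_less D f h"
proof -
  obtain m where m: "m \<in> Field D" "f m < g m" "\<And>x. (x, m) \<in> D \<Longrightarrow> x \<noteq> m \<Longrightarrow> f x = g x"
    using assms(1) unfolding hahn_less_def by blast
  obtain n where n: "n \<in> Field D" "g n < h n" "\<And>x. (x, n) \<in> D \<Longrightarrow> x \<noteq> n \<Longrightarrow> g x = h x"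
    using assms(2) unfolding hahn_less_def by blast
  consider "m = n" | "(m, n) \<in> D" "m \<noteq> n" | "(n, m) \<in> D" "m \<noteq> n" using total m n by blast
  then show ?thesis
  proof cases
    case 1
    then show ?thesis using m n unfolding hahn_less_def by (intro bexI[of _ m]) auto
  next
    case 2
    have "f x = h x" if x: "(x, m) \<in> D" "x \<noteq> m" for x
    proof -
      have "(x, n) \<in> D" "x \<noteq> n" using trans[OF x(1) 2(1)] x antisym[of m n] 2 by auto
      then show ?thesis using m(3)[OF x] n(3) by simp
    qed
    then show ?thesis using m n(3)[OF 2] unfolding hahn_less_def by (intro bexI[of _ m]) auto
  next
    case 3
    have "f x = h x" if x: "(x, n) \<in> D" "x \<noteq> n" for x
    proof -
      have "(x, m) \<in> D" "x \<noteq> m" using trans[OF x(1) 3(1)] x antisym[of m n] 3 by auto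
      then show ?thesis using n(3)[OF x] m(3) by simp
    qed
    then show ?thesis using n m(3)[of n] 3 unfolding hahn_less_def by (intro bexI[of _ n]) auto
  qed
qed

lemma hahn_less_irrefl: "\<not> hahn_less D g g"
  by (auto simp: hahn_less_def)

text \<open>Well-ordered supports provide the first place of difference: the support of h - g lies
  in their union and so has a least point.\<close>

lemma hahn_less_linear:
  assumes "wo_subset D (supp g)" "wo_subset D (supp h)"
  shows "g = h \<or> hahn_less D g h \<or> hahn_less D h g"
proof (cases "g = h")
  case False
  let ?m = "min_supp D (h - g)"
  have wo: "wo_subset D (supp (h - g))"
    using wo_subset_mono[OF wo_subset_Un[OF assms(2,1)] supp_diff] .
  have "h - g \<noteq> 0" using False by simp
  note m = min_supp_wo[OF wo this]
  have "?m \<in> Field D" using m(1) wo by (auto simp: wo_subset_def)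
  moreover have "g x = h x" if "(x, ?m) \<in> D" "x \<noteq> ?m" for x
  proof (rule ccontr)
    assume "g x \<noteq> h x"
    then have "(?m, x) \<in> D" by (intro m(2)) (simp add: supp_def)
    then show False using that antisym by blast
  qed
  moreover have "g ?m \<noteq> h ?m" using m(1) by (auto simp: supp_def)
  ultimately show ?thesis unfolding hahn_less_def by (metis linorder_neqE)
qed simp

lemma Field_hahn_order [simp]: "Field (hahn_order \<kappa> D) = hahn \<kappa> D"
  by (auto simp: Field_def hahn_order_iff)

lemma Linear_order_hahn_order: "Linear_order (hahn_order \<kappa> D)"
proof -
  have "trans (hahn_order \<kappa> D)"
    using hahn_less_trans by (intro transI) (auto simp: hahn_order_iff)
  moreover have "antisym (hahn_order \<kappa> D)"
    using hahn_less_trans hahn_less_irrefl by (intro antisymI) (auto simp: hahn_order_iff)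
  moreover have "refl_on (hahn \<kappa> D) (hahn_order \<kappa> D)"
    by (auto simp: refl_on_def hahn_order_iff)
  moreover have "total_on (hahn \<kappa> D) (hahn_order \<kappa> D)"
    using hahn_less_linear hahn_wo_subset by (auto simp: total_on_def hahn_order_iff)
  moreover have "hahn_order \<kappa> D \<subseteq> hahn \<kappa> D \<times> hahn \<kappa> D"
    by (auto simp: hahn_order_iff)
  ultimately show ?thesis by (simp add: order_on_defs)
qed

lemma zero_in_hahn: "Card_order \<kappa> \<Longrightarrow> natLeq <o \<kappa> \<Longrightarrow> 0 \<in> hahn \<kappa> D"
  by (simp add: hahn_iff wo_subset_def finite_ordLess_Card_order)

lemma uminus_in_hahn: "g \<in> hahn \<kappa> D \<Longrightarrow> - g \<in> hahn \<kappa> D"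
  by (simp add: hahn_iff)

lemma hahn_supp_Un:
  assumes "Card_order \<kappa>" "natLeq <o \<kappa>" "g \<in> hahn \<kappa> D" "h \<in> hahn \<kappa> D" "supp f \<subseteq> supp g \<union> supp h"
  shows "f \<in> hahn \<kappa> D"
proof -
  have "infinite (Field \<kappa>)"
    using Cinfinite_of_natLeq[OF assms(1,2)] by (simp add: cinfinite_def)
  then have "|supp g \<union> supp h| <o \<kappa>"
    using assms by (intro card_of_Un_ordLess_infinite_Field) (auto simp: hahn_iff)
  then have "|supp f| <o \<kappa>" using card_of_mono1[OF assms(5)] ordLeq_ordLess_trans by blast
  then show ?thesis
    using assms(3-5) wo_subset_mono[OF wo_subset_Un] by (auto simp: hahn_iff)
qed

lemma add_in_hahn:
  "Card_order \<kappa> \<Longrightarrow> natLeq <o \<kappa> \<Longrightarrow> g \<in> hahn \<kappa> D \<Longrightarrow> h \<in> hahn \<kappa> D \<Longrightarrow> g + h \<in> hahn \<kappa> D"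
  by (rule hahn_supp_Un[OF _ _ _ _ supp_add])

lemma group_chain_hahn_order:
  assumes "Card_order \<kappa>" "natLeq <o \<kappa>"
  shows "group_chain (hahn_order \<kappa> D)"
proof
  show "Linear_order (hahn_order \<kappa> D)" by (rule Linear_order_hahn_order)
  show "(x + z, y + z) \<in> hahn_order \<kappa> D"
    if "(x, y) \<in> hahn_order \<kappa> D" "z \<in> Field (hahn_order \<kappa> D)" for x y z
    using that add_in_hahn[OF assms] by (auto simp: hahn_order_iff hahn_less_def)
qed (simp_all add: zero_in_hahn[OF assms] uminus_in_hahn add_in_hahn[OF assms])

lemma hahn_neg_iff:
  assumes "Card_order \<kappa>" "natLeq <o \<kappa>"
  shows "g \<in> hahn_neg \<kappa> D \<longleftrightarrow> g \<in> hahn \<kappa> D \<and> g \<noteq> 0 \<and> g (min_supp D g) < 0"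
proof -
  have "lex_pos D (- g) \<longleftrightarrow> g \<noteq> 0 \<and> g (min_supp D g) < 0"
    by (simp add: lex_pos_def min_supp_def)
  then show ?thesis
    using zero_in_hahn[OF assms] by (auto simp: hahn_neg_def hahn_order_def lex_pos_def)
qed

text \<open>If the support of h began strictly before that of g, then h would be negative at a place
  where g still vanishes, and h would be the smaller one. The sign matters: on positive elements the
  leading index reverses the order.\<close>

lemma min_supp_mono_neg:
  assumes "Card_order \<kappa>" "natLeq <o \<kappa>"
    and "g \<in> hahn_neg \<kappa> D" "h \<in> hahn_neg \<kappa> D" "(g, h) \<in> hahn_order \<kappa> D"
  shows "(min_supp D g, min_supp D h) \<in> D"
proof (rule ccontr)
  let ?m = "min_supp D g" and ?n = "min_supp D h"
  assume not_le: "(?m, ?n) \<notin> D"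
  have g: "g \<in> hahn \<kappa> D" "g \<noteq> 0" "g ?m < 0" and h: "h \<in> hahn \<kappa> D" "h \<noteq> 0" "h ?n < 0"
    using assms(3,4) by (auto simp: hahn_neg_iff[OF assms(1,2)])
  have le: "(?n, ?m) \<in> D" and neq: "?n \<noteq> ?m"
    using total not_le refl min_supp_Field g h by metis+
  have "hahn_less D h g"
    unfolding hahn_less_def
  proof (intro bexI[of _ ?n] conjI allI impI)
    have zero: "g x = 0" if x: "(x, ?n) \<in> D" for x
    proof (rule ccontr)
      assume "g x \<noteq> 0"
      then have "(?m, x) \<in> D" using min_supp_hahn(2)[OF g(1,2)] by (simp add: supp_def)
      then show False using not_le trans x by blast
    qed
    show "h ?n < g ?n" using h(3) zero refl min_supp_Field h by metis
    fix x assume x: "(x, ?n) \<in> D \<and> x \<noteq> ?n"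
    have "h x = 0"
    proof (rule ccontr)
      assume "h x \<noteq> 0"
      then have "(?n, x) \<in> D" using min_supp_hahn(2)[OF h(1,2)] by (simp add: supp_def)
      then show False using x antisym by blast
    qed
    then show "h x = g x" using zero x by simp
  qed (use min_supp_Field h in blast)
  then show False using assms(5) hahn_less_trans hahn_less_irrefl by (auto simp: hahn_order_iff)
qed

end

section \<open>The logarithm of an infinite series\<close>

text \<open>Regularity enters twice: the (n+1)-fold sums are a union of fewer than \<kappa>
  translates of the n-fold sums, and the union over all n has countably many members, which is fewer
  than \<kappa> by uncountability.\<close>

lemma card_of_nfold_sums:
  assumes "Cinfinite \<kappa>" "regularCard \<kappa>" "natLeq <o \<kappa>" "|S| <o \<kappa>"
  shows "|\<Union>n. nfold_sums n S| <o \<kappa>"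
proof -
  have inf: "infinite (Field \<kappa>)" "Card_order \<kappa>" using assms(1) by (auto simp: cinfinite_def)
  have "|nfold_sums n S| <o \<kappa>" for n
  proof (induction n)
    case 0
    show ?case by (intro finite_ordLess_Card_order inf assms(3)) simp
  next
    case (Suc n)
    have "\<forall>a\<in>S. |(+) a ` nfold_sums n S| <o \<kappa>"
      using ordLeq_ordLess_trans[OF card_of_image Suc] by blast
    then have "|\<Union>a\<in>S. (+) a ` nfold_sums n S| <o \<kappa>"
      by (rule card_of_UNION_ordLess_infinite_Field_regularCard[OF assms(2,1,4)])
    moreover have "nfold_sums (Suc n) S = (\<Union>a\<in>S. (+) a ` nfold_sums n S)" by auto
    ultimately show ?case by simp
  qed
  moreover have "|UNIV :: nat set| <o \<kappa>"
    using assms(3) card_of_nat ordIso_ordLess_trans by blast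
  ultimately show ?thesis
    using card_of_UNION_ordLess_infinite_Field_regularCard[OF assms(2,1), of UNIV "\<lambda>n. nfold_sums n S"]
    by blast
qed

text \<open>A nonzero value forces a nonempty index set, also when that set is infinite and the sum
  is 0 by convention. Supports of products and powers can thus be bounded before any finiteness is
  known.\<close>

lemma series_mult_nonzero:
  assumes "series_mult s s' g \<noteq> 0"
  obtains a b where "g = a + b" "a \<in> supp s" "b \<in> supp s'"
proof -
  have "\<exists>a. s a \<noteq> 0 \<and> s' (g - a) \<noteq> 0"
  proof (rule ccontr)
    assume "\<not> ?thesis"
    then have empty: "{a. s a \<noteq> 0 \<and> s' (g - a) \<noteq> 0} = {}" by blast
    show False using assms unfolding series_mult_def empty by simp
  qed
  then obtain a where a: "s a \<noteq> 0" "s' (g - a) \<noteq> 0" by blast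
  show ?thesis by (rule that[of a "g - a"]) (use a in \<open>simp_all add: supp_def\<close>)
qed

lemma supp_series_power: "supp (series_power s n) \<subseteq> nfold_sums n (supp s)"
proof (induction n)
  case 0
  then show ?case by (auto simp: series_power_def supp_def indicator_def)
next
  case (Suc n)
  show ?case
  proof
    fix g assume "g \<in> supp (series_power s (Suc n))"
    then have "series_mult s (series_power s n) g \<noteq> 0"
      by (simp add: supp_def series_power_def)
    then show "g \<in> nfold_sums (Suc n) (supp s)"
      using Suc by (elim series_mult_nonzero) auto
  qed
qed

lemma series_mult_monomial:
  assumes "r \<noteq> 0"
  shows "series_mult (\<lambda>h. r * indicator {g} h) s = (\<lambda>h. r * s (h - g))"
proof
  fix h
  have "{a. r * indicator {g} a \<noteq> 0 \<and> s (h - a) \<noteq> 0} = (if s (h - g) = 0 then {} else {g})"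
    using assms by (auto simp: indicator_def split: if_splits)
  then show "series_mult (\<lambda>h. r * indicator {g} h) s h = r * s (h - g)"
    by (simp add: series_mult_def)
qed

lemma series_sum_nonzero:
  assumes "series_sum I F g \<noteq> 0"
  obtains i where "i \<in> I" "F i g \<noteq> 0"
proof -
  have "{i. i \<in> I \<and> F i g \<noteq> 0} \<noteq> {}"
    using assms by (auto simp: series_sum_def simp del: Collect_empty_eq)
  then show ?thesis using that by blast
qed

text \<open>By injectivity of l at most one monomial contributes at a given exponent, so no
  coefficients are added up or cancelled.\<close>

lemma series_sum_monomials:
  assumes "supp g \<subseteq> A" "inj_on l A"
  shows "\<gamma> \<in> A \<Longrightarrow> series_sum A (\<lambda>\<gamma> h. - g \<gamma> * indicator {l \<gamma>} h) (l \<gamma>) = - g \<gamma>"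
    and "supp (series_sum A (\<lambda>\<gamma> h. - g \<gamma> * indicator {l \<gamma>} h)) = l ` supp g"
proof -
  let ?P = "series_sum A (\<lambda>\<gamma> h. - g \<gamma> * indicator {l \<gamma>} h)"
  show at: "?P (l \<gamma>) = - g \<gamma>" if "\<gamma> \<in> A" for \<gamma>
  proof -
    have "{i \<in> A. - g i * indicator {l i} (l \<gamma>) \<noteq> (0 :: real)} = (if g \<gamma> = 0 then {} else {\<gamma>})"
      using that assms(2) by (auto simp: indicator_def inj_on_def split: if_splits)
    then show ?thesis by (simp add: series_sum_def)
  qed
  show "supp ?P = l ` supp g"
  proof (intro equalityI subsetI)
    fix h assume "h \<in> supp ?P"
    then have "?P h \<noteq> 0" by (simp add: supp_def)
    then show "h \<in> l ` supp g"
      by (elim series_sum_nonzero) (auto simp: supp_def indicator_def split: if_splits)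
  qed (use at assms(1) in \<open>auto simp: supp_def subset_iff\<close>)
qed

section \<open>Order and valuation on the series field\<close>

locale hahn_field = linear_chain \<Gamma> for \<Gamma> :: "'c rel" +
  fixes \<kappa> :: "'k rel"
  assumes Card_order: "Card_order \<kappa>" and regular: "regularCard \<kappa>" and uncountable: "natLeq <o \<kappa>"
begin

lemma Cinfinite: "Cinfinite \<kappa>"
  by (rule Cinfinite_of_natLeq[OF Card_order uncountable])

sublocale G: group_chain "hahn_order \<kappa> \<Gamma>"
  by (rule group_chain_hahn_order[OF Card_order uncountable])

sublocale K: group_chain "hahn_order \<kappa> (hahn_order \<kappa> \<Gamma>)"
  by (rule G.group_chain_hahn_order[OF Card_order uncountable])

abbreviation G :: "('c \<Rightarrow> real) set"
  where "G \<equiv> hahn \<kappa> \<Gamma>"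

abbreviation G_le :: "('c \<Rightarrow> real) rel"
  where "G_le \<equiv> hahn_order \<kappa> \<Gamma>"

abbreviation val :: "(('c \<Rightarrow> real) \<Rightarrow> real) \<Rightarrow> 'c \<Rightarrow> real"
  where "val \<equiv> valuation \<kappa> \<Gamma>"

lemma infinite_elements_iff:
  "a \<in> infinite_elements \<kappa> \<Gamma> \<longleftrightarrow>
    a \<in> hahn \<kappa> G_le \<and> a \<noteq> 0 \<and> a (val a) > 0 \<and> val a \<in> hahn_neg \<kappa> \<Gamma>"
proof -
  have lex_pos: "(0, a) \<in> series_order \<kappa> \<Gamma> \<and> a \<noteq> 0 \<longleftrightarrow>
      a \<in> hahn \<kappa> G_le \<and> a \<noteq> 0 \<and> a (val a) > 0"
  proof -
    have "0 \<in> hahn \<kappa> G_le" using K.zero_Field by simp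
    then show ?thesis
      by (auto simp: series_order_def hahn_order_def[of \<kappa> G_le] lex_pos_def valuation_def)
  qed
  have neg: "(0, val a) \<in> G_le \<longleftrightarrow> val a \<notin> hahn_neg \<kappa> \<Gamma>" if "a \<in> hahn \<kappa> G_le" "a \<noteq> 0"
  proof -
  have "val a \<in> G"
    using G.min_supp_Field[of a \<kappa>] that by (simp add: valuation_def)
  then show ?thesis
    using G.total[of 0 "val a"] G.antisym[of 0 "val a"] G.refl[of 0] G.zero_Field
    by (auto simp: hahn_neg_def)
  qed
  have "infinite_elements \<kappa> \<Gamma> =
      {a. (0, a) \<in> series_order \<kappa> \<Gamma> \<and> a \<noteq> 0} - valuation_ring \<kappa> \<Gamma>"
    by (simp add: infinite_elements_def)
  then show ?thesis
    using lex_pos neg by (auto simp: valuation_ring_def series_field_def)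
qed

text \<open>At the exponent \<open>val a\<close> the series b still vanishes while a has a positive
  coefficient, and below it both vanish.\<close>

lemma val_mono:
  assumes a: "a \<in> infinite_elements \<kappa> \<Gamma>" and b: "b \<in> infinite_elements \<kappa> \<Gamma>"
    and less: "(val a, val b) \<in> G_le" "val a \<noteq> val b"
  shows "(b, a) \<in> series_order \<kappa> \<Gamma>"
proof -
  have aK: "a \<in> hahn \<kappa> G_le" "a \<noteq> 0" "a (val a) > 0" and bK: "b \<in> hahn \<kappa> G_le" "b \<noteq> 0"
    using a b by (auto simp: infinite_elements_iff)
  have b0: "b x = 0" if "(x, val a) \<in> G_le" for x
  proof (rule ccontr)
    assume "b x \<noteq> 0"
    then have "(val b, x) \<in> G_le"
      unfolding valuation_def by (intro G.min_supp_hahn(2)[OF bK]) (simp add: supp_def)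
    then have "(val b, val a) \<in> G_le" using that G.trans by blast
    then show False using less G.antisym by blast
  qed
  have "hahn_less G_le b a"
    unfolding hahn_less_def
  proof (intro bexI[of _ "val a"] conjI allI impI)
    have "val a \<in> G" using less by (auto simp: hahn_order_iff)
    then show "val a \<in> Field G_le" by simp
    then show "b (val a) < a (val a)" using b0 aK(3) G.refl by simp
    fix x assume x: "(x, val a) \<in> G_le \<and> x \<noteq> val a"
    have "a x = 0"
    proof (rule ccontr)
      assume "a x \<noteq> 0"
      then have "(val a, x) \<in> G_le"
        unfolding valuation_def by (intro G.min_supp_hahn(2)[OF aK(1,2)]) (simp add: supp_def)
      then show False using x G.antisym by blast
    qed
    then show "b x = a x" using b0 x by simp
  qed
  then show ?thesis using aK bK by (simp add: series_order_def G.hahn_order_iff)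
qed

lemma val_antimono:
  assumes a: "a \<in> infinite_elements \<kappa> \<Gamma>" and b: "b \<in> infinite_elements \<kappa> \<Gamma>"
    and le: "(b, a) \<in> series_order \<kappa> \<Gamma>"
  shows "(val a, val b) \<in> G_le"
proof (rule ccontr)
  assume not_le: "(val a, val b) \<notin> G_le"
  have "val a \<in> G" "val b \<in> G"
    using a b by (auto simp: infinite_elements_iff hahn_neg_def hahn_order_def)
  then have "(val b, val a) \<in> G_le" "val b \<noteq> val a"
    using not_le G.total[of "val a" "val b"] G.refl[of "val a"] by auto
  then have "(a, b) \<in> series_order \<kappa> \<Gamma>" by (rule val_mono[OF b a])
  then have "a = b" using le K.antisym unfolding series_order_def by blast
  then show False using \<open>val b \<noteq> val a\<close> by simp
qed

lemma min_supp_val_antimono: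
  assumes "a \<in> infinite_elements \<kappa> \<Gamma>" "b \<in> infinite_elements \<kappa> \<Gamma>" "(b, a) \<in> series_order \<kappa> \<Gamma>"
  shows "(min_supp \<Gamma> (val a), min_supp \<Gamma> (val b)) \<in> \<Gamma>"
  using min_supp_mono_neg[OF Card_order uncountable _ _ val_antimono[OF assms]] assms(1,2)
  by (simp add: infinite_elements_iff)

text \<open>Strictness cannot be dropped: series with the same leading index occur in either order.
  This is the source of the additional logarithm in \<open>log_equiv_iff\<close>.\<close>

lemma min_supp_val_mono:
  assumes a: "a \<in> infinite_elements \<kappa> \<Gamma>" and b: "b \<in> infinite_elements \<kappa> \<Gamma>"
    and less: "(min_supp \<Gamma> (val a), min_supp \<Gamma> (val b)) \<in> \<Gamma>" "min_supp \<Gamma> (val a) \<noteq> min_supp \<Gamma> (val b)"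
  shows "(b, a) \<in> series_order \<kappa> \<Gamma>"
proof (rule ccontr)
  assume not_le: "(b, a) \<notin> series_order \<kappa> \<Gamma>"
  have "(a, b) \<in> series_order \<kappa> \<Gamma>"
    using not_le K.total[of a b] a b by (auto simp: series_order_def infinite_elements_iff)
  then have "(min_supp \<Gamma> (val b), min_supp \<Gamma> (val a)) \<in> \<Gamma>" by (rule min_supp_val_antimono[OF b a])
  then show False using less antisym by blast
qed

section \<open>Leading terms and the infinitesimal part of the logarithm\<close>

lemma infinitesimals_supp_pos:
  assumes "\<epsilon> \<in> infinitesimals \<kappa> \<Gamma>" "h \<in> supp \<epsilon>"
  shows "(0, h) \<in> G_le \<and> 0 \<noteq> h"
proof -
  have "\<epsilon> \<in> hahn \<kappa> G_le" "\<epsilon> \<noteq> 0"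
    using assms by (auto simp: infinitesimals_def series_field_def)
  then have "(val \<epsilon>, h) \<in> G_le"
    using G.min_supp_hahn(2) assms(2) by (auto simp: valuation_def)
  moreover have "(0, val \<epsilon>) \<in> G_le \<and> 0 \<noteq> val \<epsilon>"
    using assms(1) \<open>\<epsilon> \<noteq> 0\<close> by (auto simp: infinitesimals_def)
  ultimately show ?thesis using G.less_le_trans by blast
qed

text \<open>The sum starts at i = 1, so every exponent of T is a nonempty sum of positive exponents
  of \<epsilon>, hence positive. Neumann's lemma well-orders all these sums and
  \<open>card_of_nfold_sums\<close> bounds their number.\<close>

lemma log_tail:
  assumes "\<epsilon> \<in> infinitesimals \<kappa> \<Gamma>"
  defines "T \<equiv> series_sum {1..} (\<lambda>i h. (-1) ^ (i - 1) * series_power \<epsilon> i h / real i)"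
  shows "T \<in> hahn \<kappa> G_le" and "h \<in> supp T \<Longrightarrow> (0, h) \<in> G_le \<and> 0 \<noteq> h"
proof -
  have \<epsilon>: "\<epsilon> \<in> hahn \<kappa> G_le" using assms(1) by (simp add: infinitesimals_def series_field_def)
  note pos = infinitesimals_supp_pos[OF assms(1)]
  have SF: "supp \<epsilon> \<subseteq> Field G_le" using \<epsilon> by (simp add: hahn_def)
  have sub: "\<exists>n\<ge>1. h \<in> nfold_sums n (supp \<epsilon>)" if "h \<in> supp T" for h
  proof -
    have "T h \<noteq> 0" using that by (simp add: supp_def)
    then obtain i where "i \<in> {1..}" "(-1) ^ (i - 1) * series_power \<epsilon> i h / real i \<noteq> 0"
      unfolding T_def by (rule series_sum_nonzero)
    then have "i \<ge> 1" "h \<in> supp (series_power \<epsilon> i)" by (auto simp: supp_def)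
    then show ?thesis using supp_series_power by blast
  qed
  then show "(0, h) \<in> G_le \<and> 0 \<noteq> h" if "h \<in> supp T"
    using G.nfold_sums_pos[OF SF pos] that by fastforce
  have subset: "supp T \<subseteq> (\<Union>n. nfold_sums n (supp \<epsilon>))" using sub by blast
  have "wo_subset G_le (supp T)"
    using G.wo_subset_mono[OF G.wo_subset_nfold_sums[OF G.hahn_wo_subset[OF \<epsilon>] pos] subset] .
  moreover have "|supp T| <o \<kappa>"
  proof (rule ordLeq_ordLess_trans)
    show "|supp T| \<le>o |\<Union>n. nfold_sums n (supp \<epsilon>)|" using subset by (rule card_of_mono1)
    show "|\<Union>n. nfold_sums n (supp \<epsilon>)| <o \<kappa>"
      using \<epsilon> by (intro card_of_nfold_sums Cinfinite regular uncountable) (simp add: hahn_def)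
  qed
  ultimately show "T \<in> hahn \<kappa> G_le" by (simp add: G.hahn_iff)
qed

lemma decomposition_exists:
  assumes a: "a \<in> hahn \<kappa> G_le" "a \<noteq> 0"
  obtains \<epsilon> where "\<epsilon> \<in> infinitesimals \<kappa> \<Gamma>"
    "a = series_mult (\<lambda>h. a (val a) * indicator {val a} h) (indicator {0} + \<epsilon>)"
proof -
  let ?g = "val a" and ?r = "a (val a)"
  \<comment> \<open>Coefficientwise this is t^(-g) a / r - 1; division by the leading monomial
    shifts the exponents by -g.\<close>
  define \<epsilon> where "\<epsilon> = (\<lambda>h. a (h + ?g) / ?r - indicator {0} h)"
  have g_min: "?g \<in> supp a" "\<And>h. h \<in> supp a \<Longrightarrow> (?g, h) \<in> G_le"
    using G.min_supp_hahn[OF a] by (simp_all add: valuation_def)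
  then have r: "?r \<noteq> 0" by (simp add: supp_def)
  have supp_a: "supp a \<subseteq> G" using a by (simp add: hahn_def)
  have gG: "?g \<in> G" using g_min(1) supp_a by blast
  have supp_\<epsilon>: "supp \<epsilon> \<subseteq> (\<lambda>h. h - ?g) ` supp a" "0 \<notin> supp \<epsilon>"
  proof
    fix h assume h: "h \<in> supp \<epsilon>"
    have "h + ?g \<in> supp a"
      using h r by (auto simp: \<epsilon>_def supp_def indicator_def split: if_splits)
    then show "h \<in> (\<lambda>h. h - ?g) ` supp a" by (intro image_eqI[of _ _ "h + ?g"]) simp_all
  qed (simp add: supp_def \<epsilon>_def r)
  have "wo_subset G_le ((\<lambda>h. h - ?g) ` supp a)"
    by (rule G.wo_subset_image[OF G.hahn_wo_subset[OF a(1)]])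
      (use supp_a gG G.diff_Field G.diff_mono in auto)
  then have "wo_subset G_le (supp \<epsilon>)" using supp_\<epsilon>(1) by (rule G.wo_subset_mono)
  moreover have "|supp \<epsilon>| <o \<kappa>"
    using card_of_mono1[OF supp_\<epsilon>(1)] card_of_image[of "\<lambda>h. h - ?g" "supp a"] a(1)
      ordLeq_transitive ordLeq_ordLess_trans unfolding hahn_def by blast
  ultimately have \<epsilon>: "\<epsilon> \<in> hahn \<kappa> G_le" by (simp add: G.hahn_iff)
  have "(0, h) \<in> G_le \<and> h \<noteq> 0" if h: "h \<in> supp \<epsilon>" for h
  proof -
    obtain x where x: "x \<in> supp a" "h = x - ?g" using h supp_\<epsilon>(1) by blast
    then have "(?g - ?g, x - ?g) \<in> G_le" using g_min gG by (intro G.diff_mono) auto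
    then show ?thesis using x(2) h supp_\<epsilon>(2) by auto
  qed
  then have "\<epsilon> \<in> infinitesimals \<kappa> \<Gamma>"
    using \<epsilon> G.min_supp_hahn(1)[OF \<epsilon>]
    by (auto simp: infinitesimals_def series_field_def valuation_def)
  moreover have "a = series_mult (\<lambda>h. ?r * indicator {?g} h) (indicator {0} + \<epsilon>)"
    unfolding series_mult_monomial[OF r] by (simp add: \<epsilon>_def r fun_eq_iff)
  ultimately show ?thesis by (rule that)
qed

text \<open>The series 1 + \<epsilon> has least exponent 0 with coefficient 1, so g and r are read
  off as leading exponent and coefficient of a, and then \<epsilon> is determined. The definite
  description in \<open>series_log\<close> depends on this.\<close>

lemma decomposition_unique:
  assumes "g \<in> G" "r \<noteq> 0" "\<epsilon> \<in> infinitesimals \<kappa> \<Gamma>"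
    and a: "a = series_mult (\<lambda>h. r * indicator {g} h) (indicator {0} + \<epsilon>)"
  shows "g = val a" "r = a g" "\<epsilon> = (\<lambda>h. a (h + g) / r - indicator {0} h)"
proof -
  have a_eq: "a h = r * (indicator {0} (h - g) + \<epsilon> (h - g))" for h
    by (simp add: a series_mult_monomial[OF assms(2)])
  note pos = infinitesimals_supp_pos[OF assms(3)]
  have "\<epsilon> 0 = 0" using pos[of 0] by (auto simp: supp_def)
  then show "r = a g" by (simp add: a_eq)
  show "\<epsilon> = (\<lambda>h. a (h + g) / r - indicator {0} h)"
    using assms(2) by (simp add: a_eq fun_eq_iff)
  have "min_supp G_le a = g"
  proof (rule G.min_supp_eqI)
    show "g \<in> supp a" using \<open>r = a g\<close> assms(2) by (simp add: supp_def)
    fix h assume h: "h \<in> supp a"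
    have "h = g \<or> h - g \<in> supp \<epsilon>"
      using h by (auto simp: supp_def a_eq indicator_def split: if_splits)
    then have "(0, h - g) \<in> G_le" using pos G.refl[OF G.zero_Field] by auto
    then have "(0 + g, (h - g) + g) \<in> G_le" using assms(1) by (intro G.add_mono) auto
    then show "(g, h) \<in> G_le" by simp
  qed
  then show "g = val a" by (simp add: valuation_def)
qed

text \<open>The three summands of the logarithm have exponents that are negative, zero and positive,
  respectively, so nothing cancels. By monotonicity of l the least exponent comes from the leading
  index of \<open>val a\<close>, and its coefficient is positive because \<open>val a\<close> is
  negative.\<close>

lemma series_log_infinite:
  assumes l_neg: "\<And>\<gamma>. \<gamma> \<in> Field \<Gamma> \<Longrightarrow> l \<gamma> \<in> hahn_neg \<kappa> \<Gamma>"
    and l_inj: "inj_on l (Field \<Gamma>)"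
    and l_mono: "\<And>\<gamma> \<delta>. (\<gamma>, \<delta>) \<in> \<Gamma> \<Longrightarrow> (l \<gamma>, l \<delta>) \<in> G_le"
    and a: "a \<in> infinite_elements \<kappa> \<Gamma>"
  shows "series_log \<kappa> \<Gamma> l a \<in> infinite_elements \<kappa> \<Gamma>"
    and "val (series_log \<kappa> \<Gamma> l a) = l (min_supp \<Gamma> (val a))"
proof -
  let ?g = "val a" and ?r = "a (val a)"
  let ?m = "min_supp \<Gamma> ?g"
  have aK: "a \<in> hahn \<kappa> G_le" "a \<noteq> 0" and r: "?r > 0" and g: "?g \<in> hahn_neg \<kappa> \<Gamma>"
    using a by (simp_all add: infinite_elements_iff)
  have gG: "?g \<in> G" "?g \<noteq> 0" "?g ?m < 0"
    using g by (simp_all add: hahn_neg_iff[OF Card_order uncountable])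
  obtain \<epsilon> where \<epsilon>: "\<epsilon> \<in> infinitesimals \<kappa> \<Gamma>"
    "a = series_mult (\<lambda>h. ?r * indicator {?g} h) (indicator {0} + \<epsilon>)"
    using decomposition_exists[OF aK] .
  define P where "P = series_sum (Field \<Gamma>) (\<lambda>\<gamma> h. - ?g \<gamma> * indicator {l \<gamma>} h)"
  define C where "C = (\<lambda>h :: 'c \<Rightarrow> real. ln ?r * indicator {0} h)"
  define T where "T = series_sum {1..} (\<lambda>i h. (-1) ^ (i - 1) * series_power \<epsilon> i h / real i)"
  have log: "series_log \<kappa> \<Gamma> l a = P + C + T"
    unfolding series_log_def
  proof (rule the_equality)
    show "\<exists>g r \<epsilon>. g \<in> G \<and> r > 0 \<and> \<epsilon> \<in> infinitesimals \<kappa> \<Gamma> \<and>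
      a = series_mult (\<lambda>h. r * indicator {g} h) (indicator {0} + \<epsilon>) \<and>
      P + C + T = series_sum (Field \<Gamma>) (\<lambda>\<gamma> h. - g \<gamma> * indicator {l \<gamma>} h)
        + (\<lambda>h. ln r * indicator {0} h)
        + series_sum {1..} (\<lambda>i h. (-1) ^ (i - 1) * series_power \<epsilon> i h / real i)"
      using gG(1) r \<epsilon> P_def C_def T_def by blast
  next
    fix b assume "\<exists>g r \<epsilon>. g \<in> G \<and> r > 0 \<and> \<epsilon> \<in> infinitesimals \<kappa> \<Gamma> \<and>
      a = series_mult (\<lambda>h. r * indicator {g} h) (indicator {0} + \<epsilon>) \<and>
      b = series_sum (Field \<Gamma>) (\<lambda>\<gamma> h. - g \<gamma> * indicator {l \<gamma>} h)
        + (\<lambda>h. ln r * indicator {0} h)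
        + series_sum {1..} (\<lambda>i h. (-1) ^ (i - 1) * series_power \<epsilon> i h / real i)"
    then obtain g' r' \<epsilon>' where *: "g' \<in> G" "r' > 0" "\<epsilon>' \<in> infinitesimals \<kappa> \<Gamma>"
      "a = series_mult (\<lambda>h. r' * indicator {g'} h) (indicator {0} + \<epsilon>')"
      and b: "b = series_sum (Field \<Gamma>) (\<lambda>\<gamma> h. - g' \<gamma> * indicator {l \<gamma>} h)
        + (\<lambda>h. ln r' * indicator {0} h)
        + series_sum {1..} (\<lambda>i h. (-1) ^ (i - 1) * series_power \<epsilon>' i h / real i)" by blast
    have "r' \<noteq> 0" "?r \<noteq> 0" using *(2) r by simp_all
    note u = decomposition_unique[OF *(1) \<open>r' \<noteq> 0\<close> *(3,4)]
      decomposition_unique[OF gG(1) \<open>?r \<noteq> 0\<close> \<epsilon>]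
    have g'_eq: "g' = ?g" by (rule u(1))
    have r'_eq: "r' = ?r" using u(2) by (simp add: g'_eq)
    have "\<epsilon>' = \<epsilon>" by (rule HOL.trans[OF u(3) u(6)[symmetric, folded g'_eq r'_eq]])
    then show "b = P + C + T" unfolding b P_def C_def T_def g'_eq r'_eq by simp
  qed
  note T = log_tail[OF \<epsilon>(1), folded T_def]
  have supp_g: "supp ?g \<subseteq> Field \<Gamma>" using gG(1) by (simp add: hahn_def)
  have m: "?m \<in> supp ?g" "\<And>x. x \<in> supp ?g \<Longrightarrow> (?m, x) \<in> \<Gamma>"
    using min_supp_hahn[OF gG(1,2)] by simp_all
  have mF: "?m \<in> Field \<Gamma>" using m supp_g by blast
  have supp_P: "supp P = l ` supp ?g" and P_at: "P (l ?m) = - ?g ?m"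
    unfolding P_def using series_sum_monomials[OF supp_g l_inj] mF by blast+
  have lG: "l \<gamma> \<in> G" if "\<gamma> \<in> Field \<Gamma>" for \<gamma>
    using l_neg[OF that] by (simp add: hahn_neg_iff[OF Card_order uncountable])
  have "wo_subset G_le (supp P)"
    unfolding supp_P
    by (rule wo_subset_image[OF hahn_wo_subset[OF gG(1)]]) (use lG supp_g l_mono in auto)
  moreover have "|supp P| <o \<kappa>"
    unfolding supp_P using card_of_image[of l "supp ?g"] gG(1) ordLeq_ordLess_trans
    unfolding hahn_def by blast
  ultimately have "P \<in> hahn \<kappa> G_le" by (simp add: G.hahn_iff)
  moreover have supp_C: "supp C \<subseteq> {0}" by (auto simp: C_def supp_def indicator_def)
  have "C \<in> hahn \<kappa> G_le"
    unfolding G.hahn_iff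
  proof
    show "wo_subset G_le (supp C)"
      using G.wo_subset_singleton[OF G.zero_Field] supp_C by (rule G.wo_subset_mono)
    show "|supp C| <o \<kappa>"
      using supp_C by (intro finite_ordLess_Card_order Card_order uncountable) (auto dest: finite_subset)
  qed
  ultimately have bK: "P + C + T \<in> hahn \<kappa> G_le"
    using T(1) by (intro G.add_in_hahn[OF Card_order uncountable])
  have l_less: "(l ?m, 0) \<in> G_le" "l ?m \<noteq> 0" using l_neg[OF mF] by (auto simp: hahn_neg_def)
  then have not_pos: "(0, l ?m) \<notin> G_le" using G.antisym by blast
  have b_at: "(P + C + T) (l ?m) > 0"
  proof -
    have "T (l ?m) = 0" using T(2)[of "l ?m"] not_pos by (auto simp: supp_def)
    moreover have "C (l ?m) = 0" using l_less(2) by (simp add: C_def)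
    ultimately show ?thesis using P_at gG(3) by simp
  qed
  have val_b: "val (P + C + T) = l ?m"
    unfolding valuation_def[of \<kappa> \<Gamma> "P + C + T"]
  proof (rule G.min_supp_eqI)
    show "l ?m \<in> supp (P + C + T)" using b_at by (simp add: supp_def)
    fix h assume "h \<in> supp (P + C + T)"
    then have "h \<in> supp P \<or> h = 0 \<or> h \<in> supp T"
      using supp_add[of "P + C" T] supp_add[of P C] supp_C by auto
    then consider "h \<in> supp P" | "h = 0" | "h \<in> supp T" by blast
    then show "(l ?m, h) \<in> G_le"
    proof cases
      case 1
      then show ?thesis using supp_P m(2) l_mono by auto
    next
      case 2
      then show ?thesis using l_less by simp
    next
      case 3
      then show ?thesis using T(2)[OF 3] G.trans[OF l_less(1), of h] by blast
    qed
  qed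
  show "val (series_log \<kappa> \<Gamma> l a) = l ?m" by (simp add: log val_b)
  have "P + C + T \<noteq> 0" using b_at by (metis less_irrefl zero_fun_apply)
  then show "series_log \<kappa> \<Gamma> l a \<in> infinite_elements \<kappa> \<Gamma>"
    unfolding infinite_elements_iff log val_b using bK b_at l_neg[OF mF] by simp
qed

end

section \<open>Chains embedded in their Hahn groups\<close>

text \<open>Totality of D has already decided the comparison, and antisymmetry of E rules out the
  opposite decision.\<close>

lemma Linear_order_subset_eq:
  assumes "Linear_order D" "Linear_order E" "D \<subseteq> E" "x \<in> Field D" "y \<in> Field D" "(x, y) \<in> E"
  shows "(x, y) \<in> D"
proof -
  interpret D: linear_chain D by unfold_locales (rule assms(1))
  interpret E: linear_chain E by unfold_locales (rule assms(2))
  show ?thesis using D.total[OF assms(4,5)] D.refl[OF assms(4)] E.antisym[of x y] assms(3,6) by blast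
qed

text \<open>Extension by zero is the identity on functions, so groups over growing chains are
  literally nested. The last claim allows the leading index of an element to be computed in the
  smaller chain, which is what makes \<open>\<theta>\<close> descend.\<close>

lemma hahn_order_mono:
  assumes "Linear_order D" "Linear_order E" "D \<subseteq> E"
  shows "hahn_order \<kappa> D \<subseteq> hahn_order \<kappa> E" and "hahn_neg \<kappa> D \<subseteq> hahn_neg \<kappa> E"
    and "g \<in> hahn \<kappa> D \<Longrightarrow> g \<noteq> 0 \<Longrightarrow> min_supp E g = min_supp D g"
proof -
  interpret D: linear_chain D by unfold_locales (rule assms(1))
  interpret E: linear_chain E by unfold_locales (rule assms(2))
  have F: "Field D \<subseteq> Field E" using assms(3) by (rule mono_Field)
  have wo: "wo_subset E S" if "wo_subset D S" for S
    using that F assms(3) unfolding wo_subset_def by (meson order_trans subsetD)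
  have hahn: "g \<in> hahn \<kappa> E" if "g \<in> hahn \<kappa> D" for g
    using that wo by (simp add: D.hahn_iff E.hahn_iff)
  show min: "min_supp E g = min_supp D g" if "g \<in> hahn \<kappa> D" "g \<noteq> 0" for g
    using D.min_supp_hahn[OF that] assms(3) by (intro E.min_supp_eqI) auto
  have "(g, h) \<in> hahn_order \<kappa> E" if "(g, h) \<in> hahn_order \<kappa> D" for g h
  proof (cases "g = h")
    case False
    then have gh: "g \<in> hahn \<kappa> D" "h \<in> hahn \<kappa> D" "lex_pos D (h - g)"
      using that by (auto simp: hahn_order_def)
    have wo': "wo_subset D (supp (h - g))"
      using gh D.wo_subset_mono[OF D.wo_subset_Un supp_diff] D.hahn_wo_subset by blast
    have "min_supp E (h - g) = min_supp D (h - g)"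
      using D.min_supp_wo[OF wo'] False assms(3) by (intro E.min_supp_eqI) auto
    then show ?thesis using gh hahn by (simp add: hahn_order_def lex_pos_def)
  qed (use that hahn in \<open>auto simp: hahn_order_def\<close>)
  then show "hahn_order \<kappa> D \<subseteq> hahn_order \<kappa> E" by auto
  then show "hahn_neg \<kappa> D \<subseteq> hahn_neg \<kappa> E" by (auto simp: hahn_neg_def)
qed

text \<open>The invariant of the transfinite recursion. Linearity belongs to it because the order of
  the next stage is built from the images under \<open>iota\<close>; order reflection is left out,
  as it follows from injectivity and totality.\<close>

definition embedded_chain :: "'k rel \<Rightarrow> ('a, 'k) point rel \<Rightarrow> bool"
  where "embedded_chain \<kappa> \<Gamma> \<longleftrightarrow> Linear_order \<Gamma> \<and> inj_on iota (Field \<Gamma>) \<and>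
    iota ` Field \<Gamma> \<subseteq> hahn_neg \<kappa> \<Gamma> \<and>
    (\<forall>x y. (x, y) \<in> \<Gamma> \<longrightarrow> (iota x, iota y) \<in> hahn_order \<kappa> \<Gamma>)"

lemma Linear_order_Union:
  assumes lin: "\<And>D. D \<in> \<C> \<Longrightarrow> Linear_order D"
    and ch: "\<And>D E. D \<in> \<C> \<Longrightarrow> E \<in> \<C> \<Longrightarrow> D \<subseteq> E \<or> E \<subseteq> D"
  shows "Linear_order (\<Union>\<C>)"
proof -
  have pair: "\<exists>E\<in>\<C>. D \<subseteq> E \<and> D' \<subseteq> E" if "D \<in> \<C>" "D' \<in> \<C>" for D D'
    using ch[OF that] that by blast
  have "Refl (\<Union>\<C>)"
  proof (rule refl_onI)
    fix x assume "x \<in> Field (\<Union>\<C>)"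
    then obtain D where D: "D \<in> \<C>" "x \<in> Field D" by (auto simp: Field_def)
    then show "(x, x) \<in> \<Union>\<C>" using linear_chain.refl[OF linear_chain.intro[OF lin]] by blast
  qed
  moreover have "trans (\<Union>\<C>)"
  proof (rule transI)
    fix x y z assume "(x, y) \<in> \<Union>\<C>" "(y, z) \<in> \<Union>\<C>"
    then obtain D D' where "D \<in> \<C>" "(x, y) \<in> D" "D' \<in> \<C>" "(y, z) \<in> D'" by blast
    then obtain E where E: "E \<in> \<C>" "(x, y) \<in> E" "(y, z) \<in> E" using pair by blast
    then show "(x, z) \<in> \<Union>\<C>" using linear_chain.trans[OF linear_chain.intro[OF lin]] by blast
  qed
  moreover have "antisym (\<Union>\<C>)"
  proof (rule antisymI)
    fix x y assume "(x, y) \<in> \<Union>\<C>" "(y, x) \<in> \<Union>\<C>"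
    then obtain D D' where "D \<in> \<C>" "(x, y) \<in> D" "D' \<in> \<C>" "(y, x) \<in> D'" by blast
    then obtain E where E: "E \<in> \<C>" "(x, y) \<in> E" "(y, x) \<in> E" using pair by blast
    then show "x = y" using linear_chain.antisym[OF linear_chain.intro[OF lin[OF E(1)]]] by blast
  qed
  moreover have "Total (\<Union>\<C>)"
    unfolding total_on_def
  proof (intro ballI impI)
    fix x y assume "x \<in> Field (\<Union>\<C>)" "y \<in> Field (\<Union>\<C>)"
    then obtain D D' where D: "D \<in> \<C>" "x \<in> Field D" "D' \<in> \<C>" "y \<in> Field D'"
      by (auto simp: Field_def)
    obtain E where E: "E \<in> \<C>" "D \<subseteq> E" "D' \<subseteq> E" using pair D by blast
    then have "x \<in> Field E" "y \<in> Field E" using D mono_Field by blast+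
    then show "(x, y) \<in> \<Union>\<C> \<or> (y, x) \<in> \<Union>\<C>"
      using linear_chain.total[OF linear_chain.intro[OF lin[OF E(1)]]] E(1) by blast
  qed
  ultimately show ?thesis by (simp add: order_on_defs Field_def) auto
qed

text \<open>Every condition concerns at most two points, and these already lie in a common member of
  the family. The lemma serves the limit stages and the final chain alike.\<close>

lemma embedded_chain_Union:
  assumes emb: "\<And>D. D \<in> \<C> \<Longrightarrow> embedded_chain \<kappa> D"
    and ch: "\<And>D E. D \<in> \<C> \<Longrightarrow> E \<in> \<C> \<Longrightarrow> D \<subseteq> E \<or> E \<subseteq> D"
  shows "embedded_chain \<kappa> (\<Union>\<C>)"
proof -
  have lin_mem: "Linear_order D" if "D \<in> \<C>" for D
    using emb[OF that] by (simp add: embedded_chain_def)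
  have lin: "Linear_order (\<Union>\<C>)" using lin_mem ch by (rule Linear_order_Union)
  have FE: "\<exists>D\<in>\<C>. x \<in> Field D" if "x \<in> Field (\<Union>\<C>)" for x
    using that by (auto simp: Field_def)
  have sub: "hahn_order \<kappa> D \<subseteq> hahn_order \<kappa> (\<Union>\<C>)" "hahn_neg \<kappa> D \<subseteq> hahn_neg \<kappa> (\<Union>\<C>)"
    if "D \<in> \<C>" for D
    using hahn_order_mono[OF lin_mem[OF that] lin] that by blast+
  have "inj_on iota (Field (\<Union>\<C>))"
  proof (rule inj_onI)
    fix x y assume xy: "x \<in> Field (\<Union>\<C>)" "y \<in> Field (\<Union>\<C>)" "iota x = iota y"
    obtain D D' where D: "D \<in> \<C>" "x \<in> Field D" "D' \<in> \<C>" "y \<in> Field D'"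
      using FE xy by blast
    then have "\<exists>E\<in>\<C>. x \<in> Field E \<and> y \<in> Field E" using ch[OF D(1,3)] mono_Field by blast
    then show "x = y" using emb xy(3) unfolding embedded_chain_def by (blast dest: inj_onD)
  qed
  moreover have "iota ` Field (\<Union>\<C>) \<subseteq> hahn_neg \<kappa> (\<Union>\<C>)"
    using FE emb sub(2) unfolding embedded_chain_def by blast
  moreover have "(iota x, iota y) \<in> hahn_order \<kappa> (\<Union>\<C>)" if "(x, y) \<in> \<Union>\<C>" for x y
    using that emb sub(1) unfolding embedded_chain_def by blast
  ultimately show ?thesis using lin by (simp add: embedded_chain_def)
qed

lemma embedded_chain_le_iff:
  assumes "embedded_chain \<kappa> \<Gamma>" "x \<in> Field \<Gamma>" "y \<in> Field \<Gamma>"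
  shows "(x, y) \<in> \<Gamma> \<longleftrightarrow> (iota x, iota y) \<in> hahn_order \<kappa> \<Gamma>"
proof -
  interpret linear_chain \<Gamma>
    by unfold_locales (use assms(1) in \<open>simp add: embedded_chain_def\<close>)
  interpret G: linear_chain "hahn_order \<kappa> \<Gamma>"
    by unfold_locales (rule Linear_order_hahn_order)
  show ?thesis
  proof
    assume le: "(iota x, iota y) \<in> hahn_order \<kappa> \<Gamma>"
    show "(x, y) \<in> \<Gamma>"
    proof (rule ccontr)
      assume not: "(x, y) \<notin> \<Gamma>"
      then have yx: "(y, x) \<in> \<Gamma>" using total assms by blast
      then have "(iota y, iota x) \<in> hahn_order \<kappa> \<Gamma>"
        using assms(1) by (simp add: embedded_chain_def)
      then have "iota x = iota y" using le G.antisym by blast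
      then have "x = y" using assms by (auto simp: embedded_chain_def dest: inj_onD)
      then show False using not yx by simp
    qed
  qed (use assms(1) in \<open>simp add: embedded_chain_def\<close>)
qed

text \<open>For x < y the first difference of \<open>-1\<^sub>x\<close> and
  \<open>-1\<^sub>y\<close> is at x, where the former is negative and the latter 0; the minus sign
  thus preserves the order. In the second claim D is arbitrary, since the least element of a
  singleton only depends on reflexivity at that point; it is applied with the full chain.\<close>

lemma embedded_base_chain:
  fixes \<kappa> :: "'k rel" and \<Gamma>\<^sub>0 :: "'a rel"
  assumes "Card_order \<kappa>" "natLeq <o \<kappa>" "Linear_order \<Gamma>\<^sub>0"
  shows "embedded_chain \<kappa> (base_chain \<Gamma>\<^sub>0 :: ('a, 'k) point rel)"
    and "\<gamma> \<in> Field (base_chain \<Gamma>\<^sub>0 :: ('a, 'k) point rel) \<Longrightarrow>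
      (\<gamma>, \<gamma>) \<in> D \<Longrightarrow> min_supp D (iota \<gamma>) = \<gamma>"
proof -
  let ?B = "base_chain \<Gamma>\<^sub>0 :: ('a, 'k) point rel"
  have "Linear_order ?B"
    unfolding base_chain_def using assms(3) by (intro Linear_order_dir_image) (auto simp: inj_on_def)
  then interpret linear_chain ?B by unfold_locales
  have iota: "iota \<gamma> = - indicator {\<gamma>}" if "\<gamma> \<in> Field ?B" for \<gamma> :: "('a, 'k) point"
    using that by (auto simp: base_chain_def dir_image_Field)
  have supp: "supp (iota \<gamma>) = {\<gamma>}" if "\<gamma> \<in> Field ?B" for \<gamma> :: "('a, 'k) point"
    using iota[OF that] by (auto simp: supp_def indicator_def)
  have hahn: "iota \<gamma> \<in> hahn \<kappa> ?B" if "\<gamma> \<in> Field ?B" for \<gamma> :: "('a, 'k) point"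
    using supp[OF that] wo_subset_singleton[OF that] finite_ordLess_Card_order[OF assms(1,2), of "{\<gamma>}"]
    by (simp add: hahn_iff)
  have nonzero: "iota \<gamma> \<noteq> 0" if "\<gamma> \<in> Field ?B" for \<gamma> :: "('a, 'k) point"
    using supp[OF that] by auto
  show min: "min_supp D (iota \<gamma>) = \<gamma>" if "\<gamma> \<in> Field ?B" "(\<gamma>, \<gamma>) \<in> D" for \<gamma> D
    unfolding min_supp_def supp[OF that(1)] using that(2) by (intro the_equality) auto
  have neg: "iota \<gamma> \<in> hahn_neg \<kappa> ?B" if "\<gamma> \<in> Field ?B" for \<gamma> :: "('a, 'k) point"
    using hahn[OF that] nonzero[OF that] min[OF that refl[OF that]] iota[OF that]
    by (simp add: hahn_neg_iff[OF assms(1,2)])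
  have mono: "(iota x, iota y) \<in> hahn_order \<kappa> ?B" if "(x, y) \<in> ?B" for x y :: "('a, 'k) point"
  proof (cases "x = y")
    case False
    have F: "x \<in> Field ?B" "y \<in> Field ?B" using that by (auto intro: FieldI1 FieldI2)
    have "hahn_less ?B (iota x) (iota y)"
      unfolding hahn_less_def iota[OF F(1)] iota[OF F(2)]
      by (rule bexI[OF _ F(1)]) (use False that antisym in \<open>auto simp: indicator_def\<close>)
    then show ?thesis using hahn F by (simp add: hahn_order_iff)
  qed (use hahn that in \<open>auto simp: hahn_order_iff intro: FieldI1\<close>)
  have "inj_on iota (Field ?B)"
    using supp by (intro inj_onI) (metis singleton_inject)
  then show "embedded_chain \<kappa> ?B"
    using linear neg mono by (auto simp: embedded_chain_def)
qed

lemma Field_power_step: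
  assumes "Linear_order \<Gamma>" "Card_order \<kappa>"
  shows "Field (power_step \<kappa> \<Gamma>) = Field \<Gamma> \<union> new_points \<kappa> \<Gamma>"
proof -
  have "(x, x) \<in> power_step \<kappa> \<Gamma>" if x: "x \<in> new_points \<kappa> \<Gamma>" for x
  proof -
    obtain g where g: "x = new_point g" "g \<in> hahn_neg \<kappa> \<Gamma>"
      using x by (auto simp: new_points_def)
    then have "g \<in> hahn \<kappa> \<Gamma>" "g \<noteq> 0" by (auto simp: hahn_neg_def hahn_order_def)
    then have "iota x \<in> hahn \<kappa> \<Gamma>" unfolding g(1) by (subst iota_new_point[OF assms(2)])
    then show ?thesis using x by (simp add: power_step_def hahn_order_def)
  qed
  then have "new_points \<kappa> \<Gamma> \<subseteq> Field (power_step \<kappa> \<Gamma>)" by (auto intro: FieldI1)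
  moreover have "Field \<Gamma> \<subseteq> Field (power_step \<kappa> \<Gamma>)"
    by (rule mono_Field) (simp add: power_step_def)
  moreover have "Field (power_step \<kappa> \<Gamma>) \<subseteq> Field \<Gamma> \<union> new_points \<kappa> \<Gamma>"
    by (auto simp: power_step_def Field_def)
  ultimately show ?thesis by blast
qed

text \<open>The order of the new stage is the pull-back along \<open>iota\<close> of the order on
  the group over the old chain, so its linearity is inherited. The second claim, with the old chain
  on the right, records the drop by one stage.\<close>

lemma embedded_power_step:
  assumes \<kappa>: "Card_order \<kappa>" and emb: "embedded_chain \<kappa> \<Gamma>"
  shows "embedded_chain \<kappa> (power_step \<kappa> \<Gamma>)"
    and "x \<in> Field (power_step \<kappa> \<Gamma>) \<Longrightarrow> iota x \<in> hahn_neg \<kappa> \<Gamma>"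
proof -
  have lin: "Linear_order \<Gamma>" and inj: "inj_on iota (Field \<Gamma>)"
    and neg: "iota ` Field \<Gamma> \<subseteq> hahn_neg \<kappa> \<Gamma>" using emb by (simp_all add: embedded_chain_def)
  interpret linear_chain \<Gamma> by unfold_locales (rule lin)
  interpret G: linear_chain "hahn_order \<kappa> \<Gamma>" by unfold_locales (rule Linear_order_hahn_order)
  let ?\<Gamma>' = "power_step \<kappa> \<Gamma>"
  note F = Field_power_step[OF lin \<kappa>]
  have hahn: "g \<in> hahn \<kappa> \<Gamma>" "g \<noteq> 0" if "g \<in> hahn_neg \<kappa> \<Gamma>" for g
    using that by (auto simp: hahn_neg_def hahn_order_def)
  have iota_new: "iota x \<in> hahn_neg \<kappa> \<Gamma> - iota ` Field \<Gamma>" "x = new_point (iota x)"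
    if "x \<in> new_points \<kappa> \<Gamma>" for x
    using that iota_new_point[OF \<kappa> hahn] unfolding new_points_def by auto
  show iota_neg: "iota x \<in> hahn_neg \<kappa> \<Gamma>" if "x \<in> Field ?\<Gamma>'" for x
    using that neg iota_new(1) unfolding F by blast
  have inj': "inj_on iota (Field ?\<Gamma>')"
  proof (rule inj_onI)
    fix x y assume xy: "x \<in> Field ?\<Gamma>'" "y \<in> Field ?\<Gamma>'" "iota x = iota y"
    \<comment> \<open>The mixed cases are void: new points represent functions outside the image of
      the old ones.\<close>
    then consider "x \<in> Field \<Gamma>" "y \<in> Field \<Gamma>" | "x \<in> new_points \<kappa> \<Gamma>" "y \<in> new_points \<kappa> \<Gamma>"
      using iota_new(1) unfolding F by (metis DiffD2 Un_iff image_eqI)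
    then show "x = y"
    proof cases
      case 1
      then show ?thesis using inj xy(3) by (auto dest: inj_onD)
    next
      case 2
      then show ?thesis using iota_new(2) xy(3) by metis
    qed
  qed
  have step_iff: "(x, y) \<in> ?\<Gamma>' \<longleftrightarrow>
      x \<in> Field ?\<Gamma>' \<and> y \<in> Field ?\<Gamma>' \<and> (iota x, iota y) \<in> hahn_order \<kappa> \<Gamma>" for x y
  proof -
    have "(x, y) \<in> \<Gamma> \<Longrightarrow> x \<in> Field \<Gamma> \<and> y \<in> Field \<Gamma>" by (auto intro: FieldI1 FieldI2)
    then show ?thesis
      unfolding F using embedded_chain_le_iff[OF emb, of x y] by (auto simp: power_step_def)
  qed
  have lin': "Linear_order ?\<Gamma>'"
  proof -
    have "Refl ?\<Gamma>'" using iota_neg hahn(1) G.refl by (intro refl_onI) (auto simp: step_iff)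
    moreover have "trans ?\<Gamma>'" using G.trans by (intro transI) (auto simp: step_iff)
    moreover have "antisym ?\<Gamma>'"
      using G.antisym inj' by (intro antisymI) (auto simp: step_iff dest: inj_onD)
    moreover have "Total ?\<Gamma>'"
      using iota_neg hahn(1) G.total by (auto simp: total_on_def step_iff)
    ultimately show ?thesis by (simp add: order_on_defs Field_def) auto
  qed
  have sub: "\<Gamma> \<subseteq> ?\<Gamma>'" by (simp add: power_step_def)
  show "embedded_chain \<kappa> ?\<Gamma>'"
    unfolding embedded_chain_def
  proof (intro conjI allI impI lin' inj')
    show "iota ` Field ?\<Gamma>' \<subseteq> hahn_neg \<kappa> ?\<Gamma>'"
      using iota_neg hahn_order_mono(2)[OF lin lin' sub] by blast
    show "(iota x, iota y) \<in> hahn_order \<kappa> ?\<Gamma>'" if "(x, y) \<in> ?\<Gamma>'" for x y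
      using that step_iff hahn_order_mono(1)[OF lin lin' sub] by blast
  qed
qed


section \<open>The iterated lexicographic power\<close>

locale lexicographic_power =
  fixes \<kappa> :: "'k rel" and \<Gamma>\<^sub>0 :: "'a rel"
  assumes Card_order: "Card_order \<kappa>" and uncountable: "natLeq <o \<kappa>"
    and linear_base: "Linear_order \<Gamma>\<^sub>0"
begin

abbreviation stage :: "'k \<Rightarrow> ('a, 'k) point rel"
  where "stage \<equiv> power_stage \<kappa> \<Gamma>\<^sub>0"

lemma Well_order: "Well_order \<kappa>"
  using Card_order by (simp add: card_order_on_def)

sublocale wo: wo_rel \<kappa>
  by (simp add: wo_rel_def Well_order)

text \<open>Well-founded induction merged with the recursion equations, so that each case comes with
  the form of its stage.\<close>

lemma stage_induct [consumes 1, case_names zero succ limit]: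
  assumes "\<mu> \<in> Field \<kappa>"
    and zero: "\<And>\<mu>. \<mu> \<in> Field \<kappa> \<Longrightarrow> underS \<kappa> \<mu> = {} \<Longrightarrow> stage \<mu> = base_chain \<Gamma>\<^sub>0 \<Longrightarrow> P \<mu>"
    and succ: "\<And>\<alpha> \<mu>. \<mu> \<in> Field \<kappa> \<Longrightarrow> is_pred \<kappa> \<alpha> \<mu> \<Longrightarrow> \<alpha> \<in> Field \<kappa> \<Longrightarrow>
      stage \<mu> = power_step \<kappa> (stage \<alpha>) \<Longrightarrow> P \<alpha> \<Longrightarrow> P \<mu>"
    and limit: "\<And>\<mu>. \<mu> \<in> Field \<kappa> \<Longrightarrow> stage \<mu> = (\<Union>\<alpha>\<in>underS \<kappa> \<mu>. stage \<alpha>) \<Longrightarrow>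
      (\<And>\<alpha>. \<alpha> \<in> underS \<kappa> \<mu> \<Longrightarrow> \<alpha> \<in> Field \<kappa> \<and> P \<alpha>) \<Longrightarrow> P \<mu>"
  shows "P \<mu>"
  using assms(1)
proof (induction \<mu> rule: wo.well_order_induct)
  case (1 \<mu>)
  note \<mu> = 1(2)
  have IH: "\<alpha> \<in> Field \<kappa> \<and> P \<alpha>" if "\<alpha> \<in> underS \<kappa> \<mu>" for \<alpha>
    using 1(1)[rule_format, of \<alpha>] that by (auto simp: underS_def intro: FieldI1)
  consider (1) "underS \<kappa> \<mu> = {}" | (2) \<alpha> where "is_pred \<kappa> \<alpha> \<mu>"
    | (3) "underS \<kappa> \<mu> \<noteq> {}" "\<nexists>\<alpha>. is_pred \<kappa> \<alpha> \<mu>" by blast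
  then show ?case
  proof cases
    case 1
    show ?thesis by (rule zero[OF \<mu> 1 power_stage_zero[OF Well_order 1]])
  next
    case 2
    then have "\<alpha> \<in> underS \<kappa> \<mu>" by (simp add: is_pred_def)
    then have "\<alpha> \<in> Field \<kappa>" "P \<alpha>" using IH by blast+
    then show ?thesis by (intro succ[OF \<mu> 2 _ power_stage_succ[OF Well_order 2]])
  next
    case 3
    show ?thesis by (rule limit[OF \<mu> power_stage_limit[OF Well_order 3] IH])
  qed
qed

lemma stage_mono: "\<mu> \<in> Field \<kappa> \<Longrightarrow> (\<alpha>, \<mu>) \<in> \<kappa> \<Longrightarrow> stage \<alpha> \<subseteq> stage \<mu>"
proof (induction \<mu> arbitrary: \<alpha> rule: stage_induct)
  case (zero \<mu>)
  then have "\<alpha> = \<mu>" by (auto simp: underS_def)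
  then show ?case by simp
next
  case (succ \<beta> \<mu>)
  show ?case
  proof (cases "\<alpha> = \<mu>")
    case False
    then have "\<alpha> \<in> underS \<kappa> \<mu>" using succ.prems by (simp add: underS_def)
    then have "(\<alpha>, \<beta>) \<in> \<kappa>" using succ.hyps(2) by (auto simp: is_pred_def under_def)
    then have "stage \<alpha> \<subseteq> stage \<beta>" by (rule succ.IH)
    then show ?thesis using succ.hyps(4) by (auto simp: power_step_def)
  qed simp
next
  case (limit \<mu>)
  show ?case
  proof (cases "\<alpha> = \<mu>")
    case False
    then have "\<alpha> \<in> underS \<kappa> \<mu>" using limit.prems by (simp add: underS_def)
    then show ?thesis using limit.hyps(2) by blast
  qed simp
qed

lemma stage_chain:
  "\<alpha> \<in> Field \<kappa> \<Longrightarrow> \<beta> \<in> Field \<kappa> \<Longrightarrow> stage \<alpha> \<subseteq> stage \<beta> \<or> stage \<beta> \<subseteq> stage \<alpha>"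
  using stage_mono wo.TOTALS by blast

lemma embedded_stage: "\<mu> \<in> Field \<kappa> \<Longrightarrow> embedded_chain \<kappa> (stage \<mu>)"
proof (induction \<mu> rule: stage_induct)
  case (zero \<mu>)
  then show ?case using embedded_base_chain(1)[OF Card_order uncountable linear_base] by simp
next
  case (succ \<alpha> \<mu>)
  then show ?case using embedded_power_step(1)[OF Card_order] by simp
next
  case (limit \<mu>)
  show ?case
    unfolding limit(2) by (rule embedded_chain_Union) (use limit(3) stage_chain in auto)
qed

lemma embedded_power_chain: "embedded_chain \<kappa> (power_chain \<kappa> \<Gamma>\<^sub>0)"
  unfolding power_chain_def
  by (rule embedded_chain_Union) (use embedded_stage stage_chain in auto)

lemma stage_subset_power_chain: "\<mu> \<in> Field \<kappa> \<Longrightarrow> stage \<mu> \<subseteq> power_chain \<kappa> \<Gamma>\<^sub>0"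
  by (auto simp: power_chain_def)

lemma zero_stage: "\<exists>\<mu>\<in>Field \<kappa>. stage \<mu> = base_chain \<Gamma>\<^sub>0"
proof -
  have "Field \<kappa> \<noteq> {}"
    using Cinfinite_of_natLeq[OF Card_order uncountable] by (auto simp: cinfinite_def)
  then have \<mu>: "wo.minim (Field \<kappa>) \<in> Field \<kappa>" (is "?\<mu> \<in> _")
    using wo.minim_in[of "Field \<kappa>"] by simp
  have "underS \<kappa> ?\<mu> = {}"
  proof (rule ccontr)
    assume "underS \<kappa> ?\<mu> \<noteq> {}"
    then obtain x where x: "(x, ?\<mu>) \<in> \<kappa>" "x \<noteq> ?\<mu>" by (auto simp: underS_def)
    then have "(?\<mu>, x) \<in> \<kappa>" using wo.minim_least[of "Field \<kappa>" x] by (simp add: FieldI1)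
    then show False using x wo.ANTISYM antisymD by fast
  qed
  then show ?thesis using \<mu> power_stage_zero[OF Well_order] by blast
qed

end

section \<open>Ranks\<close>

text \<open>Here q is an order-reversing choice of representatives that meets every class of E. The
  isomorphism sends a class to its preimage under q. Condition \<open>le_q\<close> may change
  representatives, since \<open>quotient_chain\<close> compares classes through some pair of
  members.\<close>

lemma same_order_type_quotient:
  assumes E: "equiv (Field r) E" and E': "equiv (Field r') E'"
    and refl: "Refl r" "Refl r'"
    and q: "\<And>x. x \<in> Field r' \<Longrightarrow> q x \<in> Field r"
    and q_equiv: "\<And>x y. x \<in> Field r' \<Longrightarrow> y \<in> Field r' \<Longrightarrow> (q x, q y) \<in> E \<longleftrightarrow> (x, y) \<in> E'"
    and q_onto: "\<And>a. a \<in> Field r \<Longrightarrow> \<exists>x\<in>Field r'. (q x, a) \<in> E"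
    and q_le: "\<And>x y. (x, y) \<in> r' \<Longrightarrow> (q y, q x) \<in> r"
    and le_q: "\<And>a b x y. (b, a) \<in> r \<Longrightarrow> x \<in> Field r' \<Longrightarrow> y \<in> Field r' \<Longrightarrow>
      (q x, a) \<in> E \<Longrightarrow> (q y, b) \<in> E \<Longrightarrow> \<exists>x' y'. (x, x') \<in> E' \<and> (y, y') \<in> E' \<and> (x', y') \<in> r'"
  shows "same_order_type ((quotient_chain r E)\<inverse>) (quotient_chain r' E')"
proof -
  let ?f = "\<lambda>A. {x \<in> Field r'. q x \<in> A}"
  have Field_quotient: "Field (quotient_chain s F) = Field s // F"
    if "equiv (Field s) F" "Refl s" for s :: "'z rel" and F
  proof -
    have "(A, A) \<in> quotient_chain s F" if A: "A \<in> Field s // F" for A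
    proof -
      obtain x where x: "x \<in> A" using in_quotient_imp_non_empty[OF \<open>equiv (Field s) F\<close> A] by blast
      then have "x \<in> Field s" using in_quotient_imp_subset[OF \<open>equiv (Field s) F\<close> A] by blast
      then have "(x, x) \<in> s" using \<open>Refl s\<close> by (simp add: refl_on_def)
      then show ?thesis using A x by (auto simp: quotient_chain_def)
    qed
    then have "Field s // F \<subseteq> Field (quotient_chain s F)" by (blast intro: FieldI1)
    moreover have "Field (quotient_chain s F) \<subseteq> Field s // F"
      unfolding Field_def[of "quotient_chain s F"] by (auto simp: quotient_chain_def)
    ultimately show ?thesis by blast
  qed
  have f_class: "?f (E `` {q x}) = E' `` {x}" if "x \<in> Field r'" for x
  proof -
    have "E' `` {x} \<subseteq> Field r'" using E' by (auto simp: equiv_def refl_on_def)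
    then show ?thesis using q_equiv[OF that] by auto
  qed
  have class_q: "\<exists>x\<in>Field r'. A = E `` {q x}" if A: "A \<in> Field r // E" for A
  proof -
    obtain a where a: "a \<in> Field r" "A = E `` {a}" using A by (rule quotientE)
    obtain x where "x \<in> Field r'" "(q x, a) \<in> E" using q_onto[OF a(1)] by blast
    then show ?thesis using equiv_class_eq[OF E, of "q x" a] a(2) by blast
  qed
  have class_q': "E `` {q x} \<in> Field r // E" "E' `` {x} \<in> Field r' // E'" if "x \<in> Field r'" for x
    using that q by (simp_all add: quotientI)
  have bij: "bij_betw ?f (Field r // E) (Field r' // E')"
    unfolding bij_betw_def
  proof
    show "inj_on ?f (Field r // E)"
    proof (rule inj_onI)
      fix A B assume AB: "A \<in> Field r // E" "B \<in> Field r // E" "?f A = ?f B"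
      obtain x y where xy: "x \<in> Field r'" "A = E `` {q x}" "y \<in> Field r'" "B = E `` {q y}"
        using class_q[OF AB(1)] class_q[OF AB(2)] by blast
      then have "E' `` {x} = E' `` {y}" using AB(3) f_class by simp
      then have "(x, y) \<in> E'" by (rule eq_equiv_class[OF _ E' xy(3)])
      then have "(q x, q y) \<in> E" using q_equiv xy by blast
      then show "A = B" unfolding xy(2,4) by (rule equiv_class_eq[OF E])
    qed
    show "?f ` (Field r // E) = Field r' // E'"
    proof (intro equalityI subsetI)
      fix B assume "B \<in> ?f ` (Field r // E)"
      then obtain A where A: "A \<in> Field r // E" "B = ?f A" by blast
      obtain x where "x \<in> Field r'" "A = E `` {q x}" using class_q[OF A(1)] by blast
      then show "B \<in> Field r' // E'" using f_class class_q'(2) A(2) by simp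
    next
      fix B assume "B \<in> Field r' // E'"
      then obtain x where "x \<in> Field r'" "B = E' `` {x}" by (rule quotientE)
      then show "B \<in> ?f ` (Field r // E)"
        using f_class class_q'(1) by (intro image_eqI[of _ _ "E `` {q x}"]) simp_all
    qed
  qed
  have le: "(A, B) \<in> (quotient_chain r E)\<inverse> \<longleftrightarrow> (?f A, ?f B) \<in> quotient_chain r' E'"
    if AB: "A \<in> Field r // E" "B \<in> Field r // E" for A B
  proof -
    obtain x y where xy: "x \<in> Field r'" "A = E `` {q x}" "y \<in> Field r'" "B = E `` {q y}"
      using class_q[OF AB(1)] class_q[OF AB(2)] by blast
    have "(A, B) \<in> (quotient_chain r E)\<inverse> \<longleftrightarrow> (\<exists>a b. (q x, a) \<in> E \<and> (q y, b) \<in> E \<and> (b, a) \<in> r)"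
      using AB xy by (auto simp: quotient_chain_def)
    also have "\<dots> \<longleftrightarrow> (\<exists>x' y'. (x, x') \<in> E' \<and> (y, y') \<in> E' \<and> (x', y') \<in> r')"
    proof
      assume "\<exists>a b. (q x, a) \<in> E \<and> (q y, b) \<in> E \<and> (b, a) \<in> r"
      then show "\<exists>x' y'. (x, x') \<in> E' \<and> (y, y') \<in> E' \<and> (x', y') \<in> r'"
        using le_q xy by blast
    next
      assume "\<exists>x' y'. (x, x') \<in> E' \<and> (y, y') \<in> E' \<and> (x', y') \<in> r'"
      then obtain x' y' where *: "(x, x') \<in> E'" "(y, y') \<in> E'" "(x', y') \<in> r'" by blast
      then have "x' \<in> Field r'" "y' \<in> Field r'" by (auto intro: FieldI1 FieldI2)
      then show "\<exists>a b. (q x, a) \<in> E \<and> (q y, b) \<in> E \<and> (b, a) \<in> r"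
        using * q_le q_equiv xy by blast
    qed
    also have "\<dots> \<longleftrightarrow> (E' `` {x}, E' `` {y}) \<in> quotient_chain r' E'"
      using class_q'(2) xy by (auto simp: quotient_chain_def)
    finally show ?thesis using xy f_class by simp
  qed
  have "iso ((quotient_chain r E)\<inverse>) (quotient_chain r' E') ?f"
    unfolding iso_iff2 Field_converse Field_quotient[OF E refl(1)] Field_quotient[OF E' refl(2)]
    using bij le by blast
  then show ?thesis unfolding same_order_type_def by blast
qed

section \<open>Orbit equivalence of a monotone map\<close>

context linear_chain
begin

lemma funpow_mono_rel:
  assumes "\<And>x y. (x, y) \<in> D \<Longrightarrow> (\<tau> x, \<tau> y) \<in> D"
  shows "(x, y) \<in> D \<Longrightarrow> ((\<tau> ^^ n) x, (\<tau> ^^ n) y) \<in> D"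
  by (induction n) (use assms in auto)

lemma funpow_inflationary:
  assumes "\<And>x. x \<in> Field D \<Longrightarrow> (x, \<tau> x) \<in> D" "x \<in> Field D"
  shows "(x, (\<tau> ^^ n) x) \<in> D"
proof (induction n)
  case 0
  then show ?case using refl assms(2) by simp
next
  case (Suc n)
  then have "((\<tau> ^^ n) x, (\<tau> ^^ Suc n) x) \<in> D" using assms(1) by (simp add: FieldI2)
  then show ?case using Suc trans by blast
qed

text \<open>Transitivity adds the exponents: a bound with n steps is applied after the n-fold
  iterate of a bound with m steps. Monotonicity is what carries this, so the lemma covers
  \<open>\<theta>\<close> as well as \<sigma>.\<close>

lemma equiv_shift_equiv:
  assumes mono: "\<And>x y. (x, y) \<in> D \<Longrightarrow> (\<tau> x, \<tau> y) \<in> D"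
  shows "equiv (Field D) (shift_equiv D \<tau>)"
proof (rule equivI)
  show "shift_equiv D \<tau> \<subseteq> Field D \<times> Field D" by (auto simp: shift_equiv_def)
  show "refl_on (Field D) (shift_equiv D \<tau>)"
    using refl by (auto simp: refl_on_def shift_equiv_def intro!: exI[of _ 0])
  show "sym (shift_equiv D \<tau>)" by (auto simp: sym_def shift_equiv_def)
  show "trans (shift_equiv D \<tau>)"
  proof (rule transI)
    fix x y z assume "(x, y) \<in> shift_equiv D \<tau>" "(y, z) \<in> shift_equiv D \<tau>"
    then obtain m n where F: "x \<in> Field D" "z \<in> Field D"
      and m: "(y, (\<tau> ^^ m) x) \<in> D" "(x, (\<tau> ^^ m) y) \<in> D"
      and n: "(z, (\<tau> ^^ n) y) \<in> D" "(y, (\<tau> ^^ n) z) \<in> D"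
      by (auto simp: shift_equiv_def)
    have "((\<tau> ^^ n) y, (\<tau> ^^ n) ((\<tau> ^^ m) x)) \<in> D" "((\<tau> ^^ m) y, (\<tau> ^^ m) ((\<tau> ^^ n) z)) \<in> D"
      using m(1) n(2) by (auto intro: funpow_mono_rel mono)
    moreover have "(\<tau> ^^ n) ((\<tau> ^^ m) x) = (\<tau> ^^ (m + n)) x"
      "(\<tau> ^^ m) ((\<tau> ^^ n) z) = (\<tau> ^^ (m + n)) z"
      by (metis add.commute comp_apply funpow_add)+
    ultimately have "(z, (\<tau> ^^ (m + n)) x) \<in> D" "(x, (\<tau> ^^ (m + n)) z) \<in> D"
      using trans[OF n(1)] trans[OF m(2)] by simp_all
    then show "(x, z) \<in> shift_equiv D \<tau>" using F by (auto simp: shift_equiv_def)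
  qed
qed

text \<open>If \<open>x\<close> were not moved upwards, monotonicity would make its whole orbit nonincreasing.\<close>

lemma eventually_increasing_imp_increasing:
  assumes mono: "\<And>x y. (x, y) \<in> D \<Longrightarrow> (\<tau> x, \<tau> y) \<in> D"
    and incr: "\<And>x. x \<in> B \<Longrightarrow> (x, \<tau> x) \<in> D \<and> \<tau> x \<noteq> x"
    and x: "x \<in> Field D" "\<tau> x \<in> Field D" "(\<tau> ^^ n) x \<in> B"
  shows "(x, \<tau> x) \<in> D \<and> \<tau> x \<noteq> x"
proof (rule ccontr)
  assume "\<not> ?thesis"
  then have "(\<tau> x, x) \<in> D" using total[OF x(1,2)] refl[OF x(1)] by auto
  then have "((\<tau> ^^ n) (\<tau> x), (\<tau> ^^ n) x) \<in> D" by (rule funpow_mono_rel[rotated]) (rule mono)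
  then have "(\<tau> ((\<tau> ^^ n) x), (\<tau> ^^ n) x) \<in> D" by (simp add: funpow_swap1)
  then show False using incr[OF x(3)] antisym by blast
qed

end

section \<open>Logarithmic equivalence in terms of leading indices\<close>

context hahn_field
begin

text \<open>From series to indices the number n is kept. In the other direction it becomes n + 1:
  one more step turns p b \<le> \<theta>^n (p a) into a strict inequality, and strict inequality of
  indices decides the order of the series.\<close>

lemma log_equiv_iff:
  assumes lg: "\<And>a. a \<in> infinite_elements \<kappa> \<Gamma> \<Longrightarrow> lg a \<in> infinite_elements \<kappa> \<Gamma>"
    and p_lg: "\<And>a. a \<in> infinite_elements \<kappa> \<Gamma> \<Longrightarrow>
      min_supp \<Gamma> (val (lg a)) = \<theta> (min_supp \<Gamma> (val a))"
    and incr: "\<And>x. x \<in> Field \<Gamma> \<Longrightarrow> (x, \<theta> x) \<in> \<Gamma> \<and> \<theta> x \<noteq> x"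
    and a: "a \<in> infinite_elements \<kappa> \<Gamma>" and b: "b \<in> infinite_elements \<kappa> \<Gamma>"
  shows "(a, b) \<in> log_equiv \<kappa> \<Gamma> lg \<longleftrightarrow>
    (min_supp \<Gamma> (val a), min_supp \<Gamma> (val b)) \<in> shift_equiv \<Gamma> \<theta>"
proof -
  let ?I = "infinite_elements \<kappa> \<Gamma>" and ?p = "\<lambda>a. min_supp \<Gamma> (val a)"
  have p_Field: "?p a \<in> Field \<Gamma>" if "a \<in> ?I" for a
    using that min_supp_Field by (auto simp: infinite_elements_iff hahn_neg_def hahn_order_def)
  have pow: "(lg ^^ n) a \<in> ?I \<and> ?p ((lg ^^ n) a) = (\<theta> ^^ n) (?p a)" if "a \<in> ?I" for a n
    by (induction n) (use that lg p_lg in auto)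
  have down: "(?p b, (\<theta> ^^ n) (?p a)) \<in> \<Gamma>"
    if "a \<in> ?I" "b \<in> ?I" "((lg ^^ n) a, b) \<in> series_order \<kappa> \<Gamma>" for a b n
    using min_supp_val_antimono[OF that(2) _ that(3)] pow[OF that(1), of n] by simp
  have up: "((lg ^^ Suc n) a, b) \<in> series_order \<kappa> \<Gamma>"
    if ab: "a \<in> ?I" "b \<in> ?I" and le: "(?p b, (\<theta> ^^ n) (?p a)) \<in> \<Gamma>" for a b n
  proof -
    have "(\<theta> ^^ n) (?p a) \<in> Field \<Gamma>" using le by (rule FieldI2)
    note this = incr[OF this]
    then have "(?p b, ?p ((lg ^^ Suc n) a)) \<in> \<Gamma>" "?p b \<noteq> ?p ((lg ^^ Suc n) a)"
      using pow[OF ab(1), of "Suc n"] le trans[OF le] antisym by auto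
    then show ?thesis
      using min_supp_val_mono[OF ab(2)] pow[OF ab(1), of "Suc n"] by blast
  qed
  show ?thesis
  proof
    assume "(a, b) \<in> log_equiv \<kappa> \<Gamma> lg"
    then show "(?p a, ?p b) \<in> shift_equiv \<Gamma> \<theta>"
      using down[OF a b] down[OF b a] p_Field a b by (auto simp: log_equiv_def shift_equiv_def)
  next
    assume "(?p a, ?p b) \<in> shift_equiv \<Gamma> \<theta>"
    then obtain n where "(?p b, (\<theta> ^^ n) (?p a)) \<in> \<Gamma>" "(?p a, (\<theta> ^^ n) (?p b)) \<in> \<Gamma>"
      by (auto simp: shift_equiv_def)
    then have "((lg ^^ Suc n) a, b) \<in> series_order \<kappa> \<Gamma>" "((lg ^^ Suc n) b, a) \<in> series_order \<kappa> \<Gamma>"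
      using up a b by blast+
    then show "(a, b) \<in> log_equiv \<kappa> \<Gamma> lg" using a b unfolding log_equiv_def by blast
  qed
qed

end

section \<open>Descent of orbits to the base chain\<close>

context lexicographic_power
begin

text \<open>
  Every point of \<open>\<Gamma>\<^bsub>\<alpha>+1\<^esub>\<close> has its \<open>\<iota>\<close>-image in \<open>(\<real>\<^bsup>\<Gamma>\<^sub>\<alpha>\<^esup>)\<^sub>\<kappa>\<close>, so \<open>\<theta>\<close> maps
  \<open>\<Gamma>\<^bsub>\<alpha>+1\<^esub>\<close> into \<open>\<Gamma>\<^sub>\<alpha>\<close>.
\<close>

lemma funpow_in_base_chain:
  fixes \<sigma> :: "('a, 'k) point \<Rightarrow> ('a, 'k) point"
  assumes \<sigma>: "\<And>\<mu> \<gamma>. \<mu> \<in> Field \<kappa> \<Longrightarrow> \<gamma> \<in> Field (stage \<mu>) \<Longrightarrow> \<sigma> \<gamma> \<in> Field (stage \<mu>)"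
  defines "\<theta> \<equiv> \<lambda>\<gamma>. min_supp (power_chain \<kappa> \<Gamma>\<^sub>0) (iota (\<sigma> \<gamma>))"
  assumes "\<gamma> \<in> Field (power_chain \<kappa> \<Gamma>\<^sub>0)"
  shows "\<exists>n. (\<theta> ^^ n) \<gamma> \<in> Field (base_chain \<Gamma>\<^sub>0)"
proof -
  have "\<exists>n. (\<theta> ^^ n) \<gamma> \<in> Field (base_chain \<Gamma>\<^sub>0)" if "\<mu> \<in> Field \<kappa>" "\<gamma> \<in> Field (stage \<mu>)" for \<mu> \<gamma>
    using that
  proof (induction \<mu> arbitrary: \<gamma> rule: stage_induct)
    case (zero \<mu>)
    then show ?case by (intro exI[of _ 0]) simp
  next
    case (succ \<alpha> \<mu>)
    let ?g = "iota (\<sigma> \<gamma>)"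
    have emb: "embedded_chain \<kappa> (stage \<alpha>)" by (rule embedded_stage) (rule succ.hyps)
    then have lin: "Linear_order (stage \<alpha>)" by (simp add: embedded_chain_def)
    have lin': "Linear_order (power_chain \<kappa> \<Gamma>\<^sub>0)"
      using embedded_power_chain by (simp add: embedded_chain_def)
    have "\<sigma> \<gamma> \<in> Field (power_step \<kappa> (stage \<alpha>))"
      using \<sigma>[OF succ.hyps(1) succ.prems] succ.hyps(4) by simp
    then have "?g \<in> hahn_neg \<kappa> (stage \<alpha>)" by (rule embedded_power_step(2)[OF Card_order emb])
    then have g: "?g \<in> hahn \<kappa> (stage \<alpha>)" "?g \<noteq> 0" by (auto simp: hahn_neg_def hahn_order_def)
    have "\<theta> \<gamma> = min_supp (stage \<alpha>) ?g"
      unfolding \<theta>_def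
      by (rule hahn_order_mono(3)[OF lin lin' stage_subset_power_chain g]) (rule succ.hyps)
    then have "\<theta> \<gamma> \<in> Field (stage \<alpha>)"
      using linear_chain.min_supp_Field[OF linear_chain.intro[OF lin] g] by simp
    then obtain n where "(\<theta> ^^ n) (\<theta> \<gamma>) \<in> Field (base_chain \<Gamma>\<^sub>0)" using succ.IH by blast
    then show ?case by (intro exI[of _ "Suc n"]) (simp add: funpow_swap1)
  next
    case (limit \<mu>)
    then obtain \<alpha> where "\<alpha> \<in> underS \<kappa> \<mu>" "\<gamma> \<in> Field (stage \<alpha>)" by (auto simp: Field_def)
    then show ?case using limit.IH by blast
  qed
  moreover obtain \<mu> where "\<mu> \<in> Field \<kappa>" "\<gamma> \<in> Field (stage \<mu>)"
    using assms(3) by (auto simp: power_chain_def Field_def)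
  ultimately show ?thesis by blast
qed

end

section \<open>Comparison of the two ranks\<close>

theorem theorem8:
  fixes \<kappa> :: "'k rel"
    and \<Gamma>\<^sub>0 :: "'a rel"
    and \<sigma> :: "('a, 'k) point \<Rightarrow> ('a, 'k) point"
  assumes "Card_order \<kappa>" and "regularCard \<kappa>" and "natLeq <o \<kappa>"
    and "Linear_order \<Gamma>\<^sub>0" and "Field \<Gamma>\<^sub>0 \<noteq> {}"
    and "iso (power_chain \<kappa> \<Gamma>\<^sub>0) (power_chain \<kappa> \<Gamma>\<^sub>0) \<sigma>"
    and "\<forall>\<mu>\<in>Field \<kappa>. iso (power_stage \<kappa> \<Gamma>\<^sub>0 \<mu>) (power_stage \<kappa> \<Gamma>\<^sub>0 \<mu>) \<sigma>"
    and "\<forall>\<gamma>\<in>Field (base_chain \<Gamma>\<^sub>0). (\<gamma>, \<sigma> \<gamma>) \<in> base_chain \<Gamma>\<^sub>0 \<and> \<sigma> \<gamma> \<noteq> \<gamma>"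
  shows "same_order_type
           (log_rank \<kappa> (power_chain \<kappa> \<Gamma>\<^sub>0)
              (series_log \<kappa> (power_chain \<kappa> \<Gamma>\<^sub>0) (iota \<circ> \<sigma>)))
           (shift_rank (base_chain \<Gamma>\<^sub>0) \<sigma>)"
proof -
  define \<Gamma> where "\<Gamma> = power_chain \<kappa> \<Gamma>\<^sub>0"
  define B :: "('a, 'k) point rel" where "B = base_chain \<Gamma>\<^sub>0"
  interpret lexicographic_power \<kappa> \<Gamma>\<^sub>0 by unfold_locales (rule assms)+
  have emb: "embedded_chain \<kappa> \<Gamma>" unfolding \<Gamma>_def by (rule embedded_power_chain)
  interpret hahn_field \<Gamma> \<kappa>
    by unfold_locales (use emb assms in \<open>simp_all add: embedded_chain_def\<close>)
  let ?I = "infinite_elements \<kappa> \<Gamma>" and ?l = "iota \<circ> \<sigma>"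
  let ?lg = "series_log \<kappa> \<Gamma> ?l" and ?p = "\<lambda>a. min_supp \<Gamma> (val a)"
  define \<theta> where "\<theta> = (\<lambda>\<gamma>. min_supp \<Gamma> (iota (\<sigma> \<gamma>)))"

  have emb_B: "embedded_chain \<kappa> B"
    and min_B: "\<gamma> \<in> Field B \<Longrightarrow> (\<gamma>, \<gamma>) \<in> \<Gamma> \<Longrightarrow> min_supp \<Gamma> (iota \<gamma>) = \<gamma>" for \<gamma>
    unfolding B_def using embedded_base_chain[OF assms(1,3,4)] by blast+
  interpret B: linear_chain B by unfold_locales (use emb_B in \<open>simp add: embedded_chain_def\<close>)
  obtain \<mu>0 where \<mu>0: "\<mu>0 \<in> Field \<kappa>" "stage \<mu>0 = B" using zero_stage unfolding B_def by blast
  have B_sub: "B \<subseteq> \<Gamma>" using stage_subset_power_chain[OF \<mu>0(1)] by (simp add: \<mu>0(2) \<Gamma>_def)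
  have B_Field: "Field B \<subseteq> Field \<Gamma>" using B_sub by (rule mono_Field)
  have B_iff: "(x, y) \<in> \<Gamma> \<longleftrightarrow> (x, y) \<in> B" if "x \<in> Field B" "y \<in> Field B" for x y
    using Linear_order_subset_eq[OF B.linear linear B_sub that] B_sub by blast
  have \<sigma>_mono: "(\<sigma> x, \<sigma> y) \<in> \<Gamma>" if "(x, y) \<in> \<Gamma>" for x y
    using assms(6) that unfolding \<Gamma>_def[symmetric] iso_iff2 by (auto intro: FieldI1 FieldI2)
  have \<sigma>_Field: "\<sigma> \<gamma> \<in> Field \<Gamma>" if "\<gamma> \<in> Field \<Gamma>" for \<gamma>
    using assms(6) that unfolding \<Gamma>_def[symmetric] iso_iff2 by (auto dest: bij_betwE)
  have \<sigma>_inj: "inj_on \<sigma> (Field \<Gamma>)"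
    using assms(6) unfolding \<Gamma>_def[symmetric] iso_iff2 by (auto dest: bij_betw_imp_inj_on)
  have \<sigma>_stage: "\<sigma> \<gamma> \<in> Field (stage \<mu>)" if "\<mu> \<in> Field \<kappa>" "\<gamma> \<in> Field (stage \<mu>)" for \<mu> \<gamma>
    using assms(7) that unfolding iso_iff2 by (auto dest: bij_betwE)

  have iota_neg: "iota \<gamma> \<in> hahn_neg \<kappa> \<Gamma>" if "\<gamma> \<in> Field \<Gamma>" for \<gamma>
    using emb that by (auto simp: embedded_chain_def)
  have l_neg: "?l \<gamma> \<in> hahn_neg \<kappa> \<Gamma>" if "\<gamma> \<in> Field \<Gamma>" for \<gamma>
    using iota_neg \<sigma>_Field that by simp
  have l_inj: "inj_on ?l (Field \<Gamma>)"
    using emb \<sigma>_inj \<sigma>_Field by (intro comp_inj_on) (auto simp: embedded_chain_def intro: inj_on_subset)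
  have l_mono: "(?l \<gamma>, ?l \<delta>) \<in> G_le" if "(\<gamma>, \<delta>) \<in> \<Gamma>" for \<gamma> \<delta>
    using emb \<sigma>_mono[OF that] by (simp add: embedded_chain_def)

  have \<theta>_mono: "(\<theta> \<gamma>, \<theta> \<delta>) \<in> \<Gamma>" if "(\<gamma>, \<delta>) \<in> \<Gamma>" for \<gamma> \<delta>
    using min_supp_mono_neg[OF Card_order uncountable l_neg l_neg l_mono[OF that]] that
    by (simp add: \<theta>_def FieldI1 FieldI2)
  have \<theta>_Field: "\<theta> \<gamma> \<in> Field \<Gamma>" if "\<gamma> \<in> Field \<Gamma>" for \<gamma>
    using \<theta>_mono[OF refl[OF that]] by (rule FieldI1)
  have \<sigma>_B: "(\<gamma>, \<sigma> \<gamma>) \<in> B" "\<sigma> \<gamma> \<noteq> \<gamma>" if "\<gamma> \<in> Field B" for \<gamma>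
    using assms(8) that by (simp_all add: B_def)
  have \<theta>_B: "\<theta> \<gamma> = \<sigma> \<gamma>" if "\<gamma> \<in> Field B" for \<gamma>
    unfolding \<theta>_def using \<sigma>_B[OF that] B_Field by (intro min_B refl) (auto intro: FieldI2)
  have pow_B: "(\<theta> ^^ n) \<gamma> = (\<sigma> ^^ n) \<gamma> \<and> (\<sigma> ^^ n) \<gamma> \<in> Field B" if "\<gamma> \<in> Field B" for \<gamma> n
    by (induction n) (use that \<theta>_B \<sigma>_B(1) in \<open>auto intro: FieldI2\<close>)
  have enters_B: "\<exists>n. (\<theta> ^^ n) \<gamma> \<in> Field B" if "\<gamma> \<in> Field \<Gamma>" for \<gamma>
    unfolding \<theta>_def \<Gamma>_def B_def
    by (rule funpow_in_base_chain) (use \<sigma>_stage that \<Gamma>_def in auto)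
  have incr: "(\<gamma>, \<theta> \<gamma>) \<in> \<Gamma> \<and> \<theta> \<gamma> \<noteq> \<gamma>" if \<gamma>: "\<gamma> \<in> Field \<Gamma>" for \<gamma>
  proof -
    obtain n where n: "(\<theta> ^^ n) \<gamma> \<in> Field B" using enters_B \<gamma> by blast
    show ?thesis
    proof (rule eventually_increasing_imp_increasing[OF _ _ \<gamma> \<theta>_Field[OF \<gamma>] n])
      show "(x, \<theta> x) \<in> \<Gamma> \<and> \<theta> x \<noteq> x" if "x \<in> Field B" for x
        using \<theta>_B[OF that] \<sigma>_B[OF that] B_sub by auto
    qed (rule \<theta>_mono)
  qed

  have lg: "?lg a \<in> ?I" "?p (?lg a) = \<theta> (?p a)" if "a \<in> ?I" for a
    using series_log_infinite[of ?l, OF l_neg l_inj l_mono that] by (simp_all add: \<theta>_def)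
  have log_equiv: "(a, b) \<in> log_equiv \<kappa> \<Gamma> ?lg \<longleftrightarrow> (?p a, ?p b) \<in> shift_equiv \<Gamma> \<theta>"
    if "a \<in> ?I" "b \<in> ?I" for a b
    using that by (rule log_equiv_iff[rotated 3]) (simp_all add: lg incr)

  \<comment> \<open>The monomial whose exponent is \<open>-1\<^sub>\<gamma>\<close> for \<gamma> in
    the base: an infinite element with leading index \<gamma>.\<close>
  define q :: "('a, 'k) point \<Rightarrow> (('a, 'k) point \<Rightarrow> real) \<Rightarrow> real" where "q \<gamma> = indicator {iota \<gamma>}" for \<gamma>
  have q: "q \<gamma> \<in> ?I" "?p (q \<gamma>) = \<gamma>" if \<gamma>: "\<gamma> \<in> Field B" for \<gamma>
  proof -
    have \<gamma>\<Gamma>: "\<gamma> \<in> Field \<Gamma>" using \<gamma> B_Field by blast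
    have supp: "supp (q \<gamma>) = {iota \<gamma>}" by (auto simp: q_def supp_def indicator_def)
    have G: "iota \<gamma> \<in> Field G_le" using iota_neg[OF \<gamma>\<Gamma>] by (auto simp: hahn_neg_def hahn_order_iff)
    have val: "val (q \<gamma>) = iota \<gamma>"
      unfolding valuation_def using supp G.refl[OF G] by (intro G.min_supp_eqI) auto
    have "q \<gamma> \<in> hahn \<kappa> G_le"
      unfolding G.hahn_iff supp
      by (intro conjI G.wo_subset_singleton G finite_ordLess_Card_order Card_order uncountable) simp
    moreover have "q \<gamma> \<noteq> 0" using supp by (metis insert_not_empty supp_eq_empty_iff)
    ultimately show "q \<gamma> \<in> ?I"
      unfolding infinite_elements_iff val using iota_neg[OF \<gamma>\<Gamma>] by (simp add: q_def)
    show "?p (q \<gamma>) = \<gamma>" unfolding val using min_B[OF \<gamma>] refl[OF \<gamma>\<Gamma>] by simp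
  qed

  let ?r = "Restr (series_order \<kappa> \<Gamma>) ?I" and ?E = "log_equiv \<kappa> \<Gamma> ?lg" and ?W = "shift_equiv \<Gamma> \<theta>"
  have p_Field: "?p a \<in> Field \<Gamma>" if "a \<in> ?I" for a
    using that min_supp_Field by (auto simp: infinite_elements_iff hahn_neg_def hahn_order_def)
  have I_sub: "?I \<subseteq> Field (series_order \<kappa> \<Gamma>)"
    by (auto simp: infinite_elements_def intro: FieldI2)
  have refl_r: "Refl (series_order \<kappa> \<Gamma>)"
    using K.linear by (simp add: series_order_def order_on_defs)
  have Field_r: "Field ?r = ?I" by (rule Refl_Field_Restr2[OF refl_r I_sub])
  have equiv_W: "equiv (Field \<Gamma>) ?W" using \<theta>_mono by (rule equiv_shift_equiv)
  \<comment> \<open>Reflexivity and transitivity are pulled back from \<open>?W\<close> along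
    \<open>?p\<close>; a direct proof of transitivity would use monotonicity of the logarithm on
    series.\<close>
  have equiv_E: "equiv ?I ?E"
  proof (rule equivI)
    show "?E \<subseteq> ?I \<times> ?I" by (auto simp: log_equiv_def)
    show "refl_on ?I ?E"
      using log_equiv p_Field equiv_W by (auto simp: refl_on_def equiv_def)
    show "sym ?E" by (auto simp: sym_def log_equiv_def)
    show "trans ?E"
    proof (rule transI)
      fix a b c assume ab: "(a, b) \<in> ?E" and bc: "(b, c) \<in> ?E"
      then have I: "a \<in> ?I" "b \<in> ?I" "c \<in> ?I" by (auto simp: log_equiv_def)
      then have "(?p a, ?p b) \<in> ?W" "(?p b, ?p c) \<in> ?W" using ab bc log_equiv by blast+
      then have "(?p a, ?p c) \<in> ?W" using equiv_W unfolding equiv_def by (blast dest: transD)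
      then show "(a, c) \<in> ?E" using log_equiv I by blast
    qed
  qed
  have \<sigma>_mono_B: "(\<sigma> x, \<sigma> y) \<in> B" if "(x, y) \<in> B" for x y
    using assms(7) \<mu>0 that unfolding iso_iff2 by (auto intro: FieldI1 FieldI2)
  have W_B: "(x, y) \<in> ?W \<longleftrightarrow> (x, y) \<in> shift_equiv B \<sigma>" if "x \<in> Field B" "y \<in> Field B" for x y
    using that B_Field pow_B B_iff by (auto simp: shift_equiv_def)
  have equiv_B: "equiv (Field B) (shift_equiv B \<sigma>)" using \<sigma>_mono_B by (rule B.equiv_shift_equiv)
  have pow_equiv: "(x, (\<sigma> ^^ n) x) \<in> shift_equiv B \<sigma>" if x: "x \<in> Field B" for x n
  proof -
    have "(x, (\<sigma> ^^ m) x) \<in> B" for m using \<sigma>_B(1) x by (rule B.funpow_inflationary)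
    \<comment> \<open>Both inequalities of \<open>shift_equiv\<close> use the same exponent n: one
      is an equality, the other is satisfied with 2n steps in total.\<close>
    then have "(x, (\<sigma> ^^ n) ((\<sigma> ^^ n) x)) \<in> B" "((\<sigma> ^^ n) x, (\<sigma> ^^ n) x) \<in> B"
      using B.refl pow_B[OF x] by (simp_all flip: funpow_add comp_apply[of "\<sigma> ^^ n" "\<sigma> ^^ n"])
    then show ?thesis using x pow_B[OF x] by (auto simp: shift_equiv_def)
  qed

  have "same_order_type ((quotient_chain ?r ?E)\<inverse>) (quotient_chain B (shift_equiv B \<sigma>))"
  proof (rule same_order_type_quotient[where q = q])
    show "equiv (Field ?r) ?E" using equiv_E by (simp add: Field_r)
    show "equiv (Field B) (shift_equiv B \<sigma>)" by (rule equiv_B)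
    show "Refl ?r" using refl_r by (rule Refl_Restr)
    show "Refl B" using B.linear by (simp add: order_on_defs)
    show "q x \<in> Field ?r" if "x \<in> Field B" for x using q(1)[OF that] by (simp add: Field_r)
    show "(q x, q y) \<in> ?E \<longleftrightarrow> (x, y) \<in> shift_equiv B \<sigma>" if "x \<in> Field B" "y \<in> Field B" for x y
      using log_equiv q W_B that by simp
    show "\<exists>x\<in>Field B. (q x, a) \<in> ?E" if "a \<in> Field ?r" for a
    proof -
      have a: "a \<in> ?I" using that by (simp add: Field_r)
      obtain n where n: "(\<theta> ^^ n) (?p a) \<in> Field B" using enters_B p_Field[OF a] by blast
      \<comment> \<open>The point at which the orbit is known to lie in the base; it is equivalent
        to \<open>?p a\<close> because \<open>\<theta>\<close> moves upwards.\<close>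
      let ?x = "(\<theta> ^^ n) (?p a)"
      have \<theta>_le: "(\<gamma>, \<theta> \<gamma>) \<in> \<Gamma>" if "\<gamma> \<in> Field \<Gamma>" for \<gamma> using incr[OF that] by blast
      have "(?p a, (\<theta> ^^ m) (?p a)) \<in> \<Gamma>" for m
        by (rule funpow_inflationary[OF \<theta>_le p_Field[OF a]])
      then have "(?x, (\<theta> ^^ n) (?p a)) \<in> \<Gamma>" "(?p a, (\<theta> ^^ n) ?x) \<in> \<Gamma>"
        using n B_Field refl by (auto simp flip: funpow_add comp_apply[of "\<theta> ^^ n" "\<theta> ^^ n"])
      then have "(?x, ?p a) \<in> ?W" using n B_Field p_Field[OF a] by (auto simp: shift_equiv_def)
      then show ?thesis using n log_equiv[OF q(1)[OF n] a] q(2) by (intro bexI[of _ ?x]) simp_all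
    qed
    show "(q y, q x) \<in> ?r" if xy: "(x, y) \<in> B" for x y
    proof -
      have F: "x \<in> Field B" "y \<in> Field B" using xy by (auto intro: FieldI1 FieldI2)
      have "(q y, q x) \<in> series_order \<kappa> \<Gamma>"
      proof (cases "x = y")
        case True
        then show ?thesis using refl_r I_sub q(1) F by (auto simp: refl_on_def)
      next
        case False
        then show ?thesis using min_supp_val_mono[OF q(1) q(1)] q(2) F B_sub xy by auto
      qed
      then show ?thesis using q(1) F by simp
    qed
    show "\<exists>x' y'. (x, x') \<in> shift_equiv B \<sigma> \<and> (y, y') \<in> shift_equiv B \<sigma> \<and> (x', y') \<in> B"
      if ba: "(b, a) \<in> ?r" and xy: "x \<in> Field B" "y \<in> Field B"
        and E: "(q x, a) \<in> ?E" "(q y, b) \<in> ?E" for a b x y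
    proof -
      have I: "a \<in> ?I" "b \<in> ?I" using ba by auto
      then have "(x, ?p a) \<in> ?W" "(y, ?p b) \<in> ?W"
        using E log_equiv q xy by metis+
      \<comment> \<open>One half of each equivalence suffices: with p a \<le> p b in between, x lies
        below the (m+n)-th iterate of y. The representatives are therefore x itself and this
        iterate, which belongs to the class of y.\<close>
      then obtain m n where m: "(x, (\<theta> ^^ m) (?p a)) \<in> \<Gamma>" and n: "(?p b, (\<theta> ^^ n) y) \<in> \<Gamma>"
        by (auto simp: shift_equiv_def)
      have "(?p a, ?p b) \<in> \<Gamma>" using min_supp_val_antimono[OF I] ba by blast
      then have "(?p a, (\<theta> ^^ n) y) \<in> \<Gamma>" using n trans by blast
      then have "((\<theta> ^^ m) (?p a), (\<theta> ^^ m) ((\<theta> ^^ n) y)) \<in> \<Gamma>"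
        by (rule funpow_mono_rel[rotated]) (rule \<theta>_mono)
      then have "(x, (\<theta> ^^ (m + n)) y) \<in> \<Gamma>" using m trans by (simp add: funpow_add)
      then have "(x, (\<sigma> ^^ (m + n)) y) \<in> B" using pow_B[OF xy(2), of "m + n"] B_iff xy(1) by metis
      moreover have "(x, x) \<in> shift_equiv B \<sigma>"
        using equiv_B xy(1) by (simp add: equiv_def refl_on_def)
      ultimately show ?thesis using pow_equiv[OF xy(2)] by blast
    qed
  qed
  then show ?thesis by (simp add: log_rank_def shift_rank_def \<Gamma>_def B_def)
qed

end
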